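(* Let $g(w)=w+w^2$ and, for real $\lambda$ with $0<\lambda<1$, let $f(w)=f_\lambda(w)=\lambda w+w^2$. Let $K_f^\circ$, $K_g^\circ$ and the maps $\Phi_f$ on $K_f^\circ$, $\Phi_g$ on $K_g^\circ$ be as defined in the context. For any compact set $E\subset K_g^\circ$: (1) $E\subset K_f^\circ$ for all $f$ sufficiently close to $g$, i.e. for all $\lambda<1$ sufficiently close to $1$; and (2) $\Phi_f\to\Phi_g$ uniformly on $E$ as $f\to g$, i.e. as $\lambda\nearrow 1$.
   Context: $K_f$ and $K_g$ denote the filled Julia sets of the quadratic polynomials $f$ and $g$ (the set of points of $\mathbb{C}$ with bounded forward orbit), and $K_f^\circ$, $K_g^\circ$ their interiors. Known facts used to define the objects: there is a unique holomorphic branched covering map $\phi_f:K_f^\circ\to\mathbb{C}$ satisfying the Schröder equation $\phi_f(f(w))=\lambda\phi_f(w)$ with $\phi_f(0)=0$ and $\phi_f(-\lambda/2)=1$; it is univalent near $w=0$. There is a unique holomorphic branched covering map $\phi_g:K_g^\circ\to\mathbb{C}$ satisfying the Abel equation $\phi_g(g(w))=\phi_g(w)+1$ with $\phi_g(-1/2)=0$; it is univalent on a disk $|w+r|<r$ for small $r>0$. (Here $-\lambda/2$ and $-1/2$ are the critical points of $f$ and $g$.) Let $S_f(\tilde w)=\dfrac{\lambda(\tilde w-1)}{(\lambda-1)\tilde w}$, the Möbius map sending $0,1,\lambda$ to $\infty,0,1$ respectively. Define $\Phi_f:=S_f\circ\phi_f$ on $K_f^\circ$ (with values in the Riemann sphere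 $\mathbb{C}\cup\{\infty\}$) and $\Phi_g:=\phi_g$ on $K_g^\circ$ (with values in $\mathbb{C}$). They satisfy $\Phi_f(f(w))=\Phi_f(w)/\lambda+1$, $\Phi_f(-\lambda/2)=0$, $\Phi_g(g(w))=\Phi_g(w)+1$, $\Phi_g(-1/2)=0$. Since $\Phi_g(E)$ is compact in $\mathbb{C}$, uniform convergence on $E$ in the spherical metric is equivalent to $\Phi_f$ being finite on $E$ for $\lambda$ close to $1$ and converging uniformly in the Euclidean metric. *)

theory Defs
  imports "HOL-Complex_Analysis.Complex_Analysis"
begin

definition quad_f :: "real \<Rightarrow> complex \<Rightarrow> complex" where
  "quad_f l w = of_real l * w + w\<^sup>2"

definition quad_g :: "complex \<Rightarrow> complex" where
  "quad_g w = w + w\<^sup>2"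

definition filled_julia :: "(complex \<Rightarrow> complex) \<Rightarrow> complex set" where
  "filled_julia p = {w. bounded (range (\<lambda>n. (p ^^ n) w))}"

text \<open>Branched coverings in the sense of Milnor: every point of the target has a connected
  neighbourhood such that each component of its preimage maps onto it by a proper map.\<close>

definition holomorphic_branched_covering ::
  "(complex \<Rightarrow> complex) \<Rightarrow> complex set \<Rightarrow> complex set \<Rightarrow> bool" where
  "holomorphic_branched_covering p S T \<longleftrightarrow>
     p holomorphic_on S \<and> p ` S = T \<and>
     (\<forall>z\<in>T. \<exists>U. z \<in> U \<and> open U \<and> connected U \<and> U \<subseteq> T \<and>
        (\<forall>V\<in>components (S \<inter> p -` U).
           p ` V = U \<and> proper_map (top_of_set V) (top_of_set U) p))"

text \<open>The two predicates below determine the map on the interior of the filled Julia set, not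
  outside of it. In the Abel case univalence on a disk tangent to the imaginary axis at \<open>0\<close> is needed
  for this: post-composing a solution with \<open>z \<mapsto> z + a * sin (2 * pi * z)\<close> gives
  another branched covering that satisfies the Abel equation with the same normalisation.\<close>

definition schroeder_map :: "real \<Rightarrow> (complex \<Rightarrow> complex) \<Rightarrow> bool" where
  "schroeder_map l \<phi> \<longleftrightarrow>
     holomorphic_branched_covering \<phi> (interior (filled_julia (quad_f l))) UNIV \<and>
     (\<forall>w\<in>interior (filled_julia (quad_f l)). \<phi> (quad_f l w) = of_real l * \<phi> w) \<and>
     \<phi> 0 = 0 \<and> \<phi> (- of_real l / 2) = 1 \<and>
     (\<exists>r>0. ball 0 r \<subseteq> interior (filled_julia (quad_f l)) \<and> inj_on \<phi> (ball 0 r))"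

definition abel_map :: "(complex \<Rightarrow> complex) \<Rightarrow> bool" where
  "abel_map \<phi> \<longleftrightarrow>
     holomorphic_branched_covering \<phi> (interior (filled_julia quad_g)) UNIV \<and>
     (\<forall>w\<in>interior (filled_julia quad_g). \<phi> (quad_g w) = \<phi> w + 1) \<and>
     \<phi> (- 1 / 2) = 0 \<and>
     (\<exists>r>0. ball (- of_real r) r \<subseteq> interior (filled_julia quad_g) \<and>
             inj_on \<phi> (ball (- of_real r) r))"

text \<open>The Riemann sphere is represented by \<^typ>\<open>complex option\<close>, with \<^term>\<open>None\<close> as the point
  at infinity. The source of this Moebius map is only the finite plane, where \<open>\<phi>\<^sub>f\<close> takes its values.\<close>

definition moebius_S :: "real \<Rightarrow> complex \<Rightarrow> complex option" where
  "moebius_S l z =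
     (if z = 0 then None else Some (of_real l * (z - 1) / ((of_real l - 1) * z)))"

end

theory Submission
  imports Defs "HOL-Real_Asymp.Real_Asymp"
begin

text \<open>
  In the coordinate \<open>Z = - l\<^sup>2 / w\<close>, which sends the fixed point \<open>0\<close> to infinity, the map \<open>w \<mapsto> l w + w\<^sup>2\<close>
  reads \<open>Z \<mapsto> Z / l + 1 + l / (Z - l)\<close>, for \<open>l = 1\<close> as well as for \<open>l < 1\<close>. This is a small
  perturbation of the affine map \<open>Z \<mapsto> Z / l + 1\<close>, whose \<open>n\<close>-th iterate has derivative \<open>l\<^sup>-\<^sup>n\<close>. So for
  two orbits \<open>Z\<^sub>n\<close> and \<open>Y\<^sub>n\<close> the scaled difference \<open>l\<^sup>n (Z\<^sub>n - Y\<^sub>n)\<close> should converge. The term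
  \<open>l / (Z - l)\<close> contributes increments of size \<open>1 / n\<close> to a single scaled orbit, which are not summable
  uniformly in \<open>l\<close>; to the difference it contributes increments of size \<open>1 / n\<^sup>2\<close>, and the convergence
  is uniform up to and including the parameter \<open>l = 1\<close>
  (\<open>scaled_difference_increment\<close>, \<open>scaled_difference_continuous_limit\<close>). The limit \<open>L (l, w)\<close> is therefore
  jointly continuous, and both linearising coordinates are read off from it.

  The estimate needs the orbits to be in the half-plane \<open>Re Z > 4\<close>, the petal. That every point of the
  interior of the filled Julia set of \<open>g\<close> reaches it (\<open>interior_enters_petal\<close>) is seen from the metric
  \<open>\<bar>dw\<bar> / \<bar>Im w\<bar>\<close> off the real line, which \<open>g\<close> expands, while the derivatives of the
  iterates of \<open>g\<close> stay bounded on the interior. A compact set then enters the petal at one common time,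
  and still does so for nearby parameters, which gives the first claim.

  For \<open>l < 1\<close> the Schroeder map is \<open>a w + O(w\<^sup>2)\<close> at \<open>0\<close>, so \<open>1 / \<phi>\<^sub>f\<close> is affine in \<open>Z\<close> up to a bounded
  error, which the factor \<open>l\<^sup>n\<close> removes. Hence \<open>\<Phi>\<^sub>f\<close> is an affine function of \<open>L (l, w)\<close>, and its values
  \<open>0\<close> at the critical point and \<open>1\<close> at the critical value determine it
  (\<open>moebius_schroeder_eq_quotient\<close>). For \<open>l = 1\<close> the Abel map is univalent on disks of radius tending to
  infinity around the orbit points, and a univalent map on a large disk is almost affine
  (\<open>univalent_almost_affine\<close>), so differences of its values are the limits of \<open>Z\<^sub>n - Y\<^sub>n\<close>
  (\<open>abel_map_difference\<close>). The two formulas agree at \<open>l = 1\<close>, and uniform continuity of \<open>L\<close> on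
  compact sets gives the second claim.
\<close>

section \<open>Univalent functions on large disks\<close>

lemma holomorphic_quadratic_remainder:
  fixes h :: "complex \<Rightarrow> complex"
  assumes hol: "h holomorphic_on ball 0 s" and s: "0 < s"
    and bound: "\<And>z. z \<in> ball 0 s \<Longrightarrow> norm (h z) \<le> B"
    and z: "norm z \<le> s / 2"
  shows "norm (h z - h 0 - deriv h 0 * z) \<le> 32 * B / s\<^sup>2 * (norm z)\<^sup>2"
proof -
  define S where "S = cball (0::complex) (s/2)"
  have sub: "cball x (s/4) \<subseteq> ball 0 s" if "x \<in> S" for x
  proof
    fix y assume "y \<in> cball x (s/4)"
    then have "norm y \<le> norm x + s/4"
      using norm_triangle_sub[of y x] by (simp add: dist_norm norm_minus_commute)
    with that s show "y \<in> ball 0 s" by (simp add: S_def)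
  qed
  have second: "norm ((deriv ^^ Suc 1) h x) \<le> 32 * B / s\<^sup>2" if "x \<in> S" for x
  proof -
    have "norm ((deriv ^^ 2) h x) \<le> fact 2 * B / (s/4)^2"
    proof (rule Cauchy_inequality)
      show "h holomorphic_on ball x (s/4)"
        using holomorphic_on_subset[OF hol] sub[OF that] ball_subset_cball by blast
      show "continuous_on (cball x (s/4)) h"
        using holomorphic_on_imp_continuous_on[OF hol] continuous_on_subset sub[OF that] by blast
      show "norm (h y) \<le> B" if "norm (x - y) = s/4" for y
        using sub[OF \<open>x \<in> S\<close>] that by (intro bound) (auto simp: dist_norm subset_iff)
    qed (use s in auto)
    then show ?thesis
      by (simp add: numeral_2_eq_2 field_simps)
  qed
  have "norm ((deriv ^^ 0) h z - (\<Sum>i\<le>1. (deriv ^^ i) h 0 * (z - 0) ^ i / fact i))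
          \<le> 32 * B / s\<^sup>2 * norm (z - 0) ^ Suc 1 / fact 1"
  proof (rule field_Taylor[where S = S and f = "\<lambda>i. (deriv ^^ i) h"])
    show "((deriv ^^ i) h has_field_derivative (deriv ^^ Suc i) h x) (at x within S)"
      if "x \<in> S" for i x
      using has_field_derivative_higher_deriv[OF hol open_ball, of x i] that s
      by (auto simp: S_def intro: has_field_derivative_at_within)
  qed (use s z second in \<open>auto simp: S_def\<close>)
  then show ?thesis
    by (simp add: power2_eq_square algebra_simps)
qed

text \<open>
  If the image contained the disk of radius \<open>4\<close>, the inverse function would map it into the disk of
  radius \<open>2\<close> with derivative \<open>1\<close> at \<open>0\<close>, against Cauchy's inequality.
\<close>

lemma univalent_omits_small_value:
  fixes h :: "complex \<Rightarrow> complex"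
  assumes hol: "h holomorphic_on ball 0 2" and inj: "inj_on h (ball 0 2)"
    and h0: "h 0 = 0" and dh0: "deriv h 0 = 1"
  obtains a where "a \<notin> h ` ball 0 2" "norm a < 4"
proof -
  have "\<not> ball 0 4 \<subseteq> h ` ball 0 2"
  proof
    assume sub: "ball 0 4 \<subseteq> h ` ball 0 2"
    obtain k where k: "k holomorphic_on h ` ball 0 2"
      "\<And>z. z \<in> ball 0 2 \<Longrightarrow> deriv h z * deriv k (h z) = 1"
      "\<And>z. z \<in> ball 0 2 \<Longrightarrow> k (h z) = z"
      using holomorphic_has_inverse[OF hol open_ball inj] by metis
    have "deriv k 0 = 1"
      using k(2)[of 0] h0 dh0 by simp
    moreover have "norm ((deriv ^^ 1) k 0) \<le> fact 1 * 2 / 3 ^ 1"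
    proof (rule Cauchy_inequality)
      have sub3: "cball 0 3 \<subseteq> h ` ball 0 2"
        using sub by (auto simp: subset_iff)
      show "k holomorphic_on ball 0 3"
        using holomorphic_on_subset[OF k(1)] sub3 ball_subset_cball by blast
      show "continuous_on (cball 0 3) k"
        using holomorphic_on_imp_continuous_on[OF k(1)] continuous_on_subset sub3 by blast
      show "norm (k x) \<le> 2" if "norm (0 - x) = 3" for x
      proof -
        have "x \<in> h ` ball 0 2" using sub3 that by auto
        then show ?thesis using k(3) by fastforce
      qed
    qed auto
    ultimately show False by simp
  qed
  then show ?thesis using that by (auto simp: subset_iff)
qed

text \<open>
  A weak form of Koebe's growth theorem, where only the existence of some constant matters. If \<open>h\<close> omits \<open>a\<close>,
  a branch \<open>q\<close> of \<open>sqrt (h - a)\<close> omits \<open>0\<close> and, \<open>h\<close> being injective, also \<open>- q 0\<close>. So \<open>- q / q 0\<close> omits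
  \<open>0\<close> and \<open>1\<close> and has the value \<open>- 1\<close> at the centre, and Schottky's theorem bounds it by a constant that does
  not depend on \<open>h\<close>.
\<close>

lemma univalent_growth_bound:
  obtains C :: real where "C > 0"
    "\<And>h z. \<lbrakk>h holomorphic_on ball 0 2; inj_on h (ball 0 2); h 0 = 0; deriv h 0 = 1; norm z < 1/2\<rbrakk>
        \<Longrightarrow> norm (h z) \<le> C"
proof -
  define M :: real where "M = exp (pi * exp (pi * (2 + 2 * 1 + 12 * (1/2) / (1 - 1/2))))"
  show ?thesis
  proof (rule that[of "4 + 4 * M\<^sup>2"])
    show "0 < 4 + 4 * M\<^sup>2" by (simp add: add_pos_nonneg)
  next
    fix h :: "complex \<Rightarrow> complex" and z :: complex
    assume hol: "h holomorphic_on ball 0 2" and inj: "inj_on h (ball 0 2)"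
      and h0: "h 0 = 0" and dh0: "deriv h 0 = 1" and z: "norm z < 1/2"
    obtain a where a: "a \<notin> h ` ball 0 2" "norm a < 4"
      using univalent_omits_small_value[OF hol inj h0 dh0] .
    have ha: "(\<lambda>z. h z - a) holomorphic_on ball 0 2" "\<And>z. z \<in> ball 0 2 \<Longrightarrow> h z - a \<noteq> 0"
      using a by (auto intro!: holomorphic_intros hol)
    then obtain q where q: "q holomorphic_on ball 0 2"
      "\<And>z. z \<in> ball 0 2 \<Longrightarrow> h z - a = (q z)\<^sup>2"
    proof -
      have "\<exists>q. q holomorphic_on ball 0 2 \<and> (\<forall>z\<in>ball 0 2. h z - a = (q z)\<^sup>2)"
        using simply_connected_eq_holomorphic_sqrt[OF open_ball, of "0::complex" 2,
            THEN iffD1, OF convex_imp_simply_connected[OF convex_ball],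
            THEN conjunct2, rule_format, of "\<lambda>z. h z - a"] ha by blast
      then show thesis using that by blast
    qed
    have q_nz: "q z \<noteq> 0" if "z \<in> ball 0 2" for z
      using q(2)[OF that] a that by auto
    have norm_q0: "(norm (q 0))\<^sup>2 = norm a"
      using q(2)[of 0] h0 by (metis centre_in_ball diff_0 norm_minus_cancel norm_power zero_less_numeral)
    have "norm (- q z / q 0) \<le> M"
      unfolding M_def
    proof (rule Schottky[where f = "\<lambda>z. - q z / q 0"])
      show "(\<lambda>z. - q z / q 0) holomorphic_on cball 0 1"
        by (intro holomorphic_intros holomorphic_on_subset[OF q(1)]) (use q_nz in auto)
      show "norm (- q 0 / q 0) \<le> 1" using q_nz[of 0] by simp
      show "\<not> (- q z / q 0 = 0 \<or> - q z / q 0 = 1)" if "z \<in> cball 0 1" for z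
      proof
        have zb: "z \<in> ball 0 2" using that by auto
        assume "- q z / q 0 = 0 \<or> - q z / q 0 = 1"
        then have "- q z = q 0"
          using q_nz[OF zb] q_nz[of 0] by (auto simp: field_simps)
        then have "q z = - q 0" by (metis minus_minus)
        then have "h z = h 0"
          using q(2)[OF zb] q(2)[of 0]
          by (metis centre_in_ball diff_add_cancel power2_minus zero_less_numeral)
        then have "z = 0" using inj zb by (auto simp: inj_on_def)
        then show False using \<open>q z = - q 0\<close> q_nz[of 0] by simp
      qed
    qed (use z in auto)
    then have "norm (q z) \<le> M * norm (q 0)"
      using q_nz[of 0] by (simp add: norm_divide field_simps)
    then have "(norm (q z))\<^sup>2 \<le> M\<^sup>2 * norm a"
      by (metis norm_ge_zero norm_q0 power_mono power_mult_distrib)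
    then have "norm (h z - a) \<le> M\<^sup>2 * norm a"
      using q(2)[of z] z by (simp add: norm_power)
    also have "\<dots> \<le> M\<^sup>2 * 4" using a(2) by (intro mult_left_mono) auto
    finally have "norm (h z) \<le> norm a + M\<^sup>2 * 4"
      using norm_triangle_sub[of "h z" a] by linarith
    with a(2) show "norm (h z) \<le> 4 + 4 * M\<^sup>2" by linarith
  qed
qed

text \<open>
  After normalisation to the disk of radius \<open>2\<close> this is the quadratic Taylor remainder of a function that obeys
  the growth bound. For a fixed increment \<open>t\<close> the relative error is \<open>O(1 / \<rho>)\<close>.
\<close>

lemma univalent_almost_affine:
  obtains C :: real where "C > 0"
    "\<And>\<psi> p \<rho> t. \<lbrakk>\<psi> holomorphic_on ball p \<rho>; inj_on \<psi> (ball p \<rho>); norm t \<le> \<rho> / 8; 0 < \<rho>\<rbrakk>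
       \<Longrightarrow> norm (\<psi> (p + t) - \<psi> p - deriv \<psi> p * t) \<le> C * norm (deriv \<psi> p) * (norm t)\<^sup>2 / \<rho>"
proof -
  obtain C where C: "C > 0" and growth:
    "\<And>h z. \<lbrakk>h holomorphic_on ball 0 2; inj_on h (ball 0 2); h 0 = 0; deriv h 0 = 1; norm z < 1/2\<rbrakk>
        \<Longrightarrow> norm (h z) \<le> C"
    using univalent_growth_bound by metis
  show ?thesis
  proof (rule that[of "256 * C"])
    fix \<psi> :: "complex \<Rightarrow> complex" and p t :: complex and \<rho> :: real
    assume hol: "\<psi> holomorphic_on ball p \<rho>" and inj: "inj_on \<psi> (ball p \<rho>)"
      and t: "norm t \<le> \<rho> / 8" and \<rho>: "0 < \<rho>"
    define d where "d = deriv \<psi> p"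
    define s :: complex where "s = of_real (\<rho> / 2)"
    have d: "d \<noteq> 0"
      unfolding d_def using holomorphic_injective_imp_regular[OF hol open_ball inj] \<rho> by simp
    have s: "s \<noteq> 0" and norm_s: "norm s = \<rho> / 2" using \<rho> by (simp_all add: s_def)
    define h where "h = (\<lambda>z. (\<psi> (p + s * z) - \<psi> p) / (d * s))"
    have inball: "p + s * z \<in> ball p \<rho>" if "z \<in> ball 0 2" for z
    proof -
      have "norm s * norm z < norm s * 2"
        using that s by (intro mult_strict_left_mono) auto
      then have "norm (s * z) < \<rho>"
        unfolding norm_mult norm_s by simp
      then show ?thesis by (simp add: dist_norm)
    qed
    have holh: "h holomorphic_on ball 0 2"
      unfolding h_def using d s
      by (intro holomorphic_intros holomorphic_on_compose_gen[OF _ hol, unfolded o_def])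
         (use inball in auto)
    have injh: "inj_on h (ball 0 2)"
    proof (rule inj_onI)
      fix x y assume xy: "x \<in> ball 0 2" "y \<in> ball 0 2" "h x = h y"
      then have "\<psi> (p + s * x) = \<psi> (p + s * y)" using d s by (simp add: h_def)
      then have "p + s * x = p + s * y" using inj inball xy by (meson inj_onD)
      then show "x = y" using s by simp
    qed
    have dh0: "deriv h 0 = 1"
    proof -
      have "(\<psi> has_field_derivative d) (at (p + s * 0))"
        unfolding d_def using holomorphic_derivI[OF hol open_ball, of p] \<rho> by simp
      then have "((\<lambda>z. \<psi> (p + s * z)) has_field_derivative d * s) (at 0)"
        by (rule DERIV_chain2) (auto intro!: derivative_eq_intros)
      then have "(h has_field_derivative (d * s - 0) / (d * s)) (at 0)"
        unfolding h_def by (intro DERIV_cdivide DERIV_diff DERIV_const)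
      then show ?thesis using d s by (simp add: DERIV_imp_deriv)
    qed
    have h0: "h 0 = 0" by (simp add: h_def)
    have nt: "norm (t / s) = 2 * norm t / \<rho>"
      unfolding norm_divide norm_s by simp
    have "norm (h (t / s) - h 0 - deriv h 0 * (t / s)) \<le> 32 * C / (1/2)\<^sup>2 * (norm (t / s))\<^sup>2"
    proof (rule holomorphic_quadratic_remainder)
      show "h holomorphic_on ball 0 (1/2)"
        by (rule holomorphic_on_subset[OF holh]) auto
      show "norm (t / s) \<le> 1 / 2 / 2"
        unfolding nt using t \<rho> by (simp add: field_simps)
    qed (use growth[OF holh injh h0 dh0] in auto)
    then have "norm (h (t / s) - t / s) \<le> 128 * C * (2 * norm t / \<rho>)\<^sup>2"
      using h0 dh0 nt by (simp add: power2_eq_square)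
    then have "norm (d * s) * norm (h (t / s) - t / s)
        \<le> norm (d * s) * (128 * C * (2 * norm t / \<rho>)\<^sup>2)"
      by (intro mult_left_mono) auto
    also have "\<dots> = 256 * C * norm d * (norm t)\<^sup>2 / \<rho>"
      unfolding norm_mult norm_s using \<rho> by (simp add: power2_eq_square field_simps)
    also have "norm (d * s) * norm (h (t / s) - t / s) = norm (\<psi> (p + t) - \<psi> p - d * t)"
    proof -
      have "d * s * (h (t / s) - t / s) = \<psi> (p + t) - \<psi> p - d * t"
        using d s by (simp add: h_def field_simps)
      then show ?thesis by (metis norm_mult)
    qed
    finally show "norm (\<psi> (p + t) - \<psi> p - deriv \<psi> p * t)
        \<le> 256 * C * norm (deriv \<psi> p) * (norm t)\<^sup>2 / \<rho>"
      by (simp add: d_def)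
  qed (use C in auto)
qed

section \<open>The quadratic family in the coordinate at infinity\<close>

text \<open>
  The factor \<open>l\<^sup>2\<close> makes the constant term of the conjugated map equal to \<open>1\<close>, see \<open>inv_coord_quad_f\<close>.
\<close>

definition inv_coord :: "real \<Rightarrow> complex \<Rightarrow> complex" where
  "inv_coord l w = - (of_real l)\<^sup>2 / w"

text \<open>
  By \<open>petal_iff_disk\<close> this is a disk tangent to the imaginary axis at \<open>0\<close>. The bound \<open>4\<close> is a convenient
  value, large enough for the perturbation \<open>l / (Z - l)\<close> to be at most \<open>1 / 3\<close>. The point \<open>0\<close>, where
  \<open>inv_coord\<close> takes the default value \<open>0\<close>, does not belong to the petal.
\<close>

definition petal :: "real \<Rightarrow> complex set" where
  "petal l = {w. 4 < Re (inv_coord l w)}"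

lemma quad_g_eq_quad_f: "quad_g = quad_f 1"
  by (auto simp: fun_eq_iff quad_g_def quad_f_def)

lemma petal_nonzero: "w \<in> petal l \<Longrightarrow> w \<noteq> 0"
  by (auto simp: petal_def inv_coord_def)

lemma petal_iff_disk: "l \<noteq> 0 \<Longrightarrow> w \<in> petal l \<longleftrightarrow> 4 * (norm w)\<^sup>2 + l\<^sup>2 * Re w < 0"
proof (cases "w = 0")
  case False
  have "Re (inv_coord l w) = - l\<^sup>2 * Re w / (norm w)\<^sup>2"
    unfolding cmod_power2 by (simp add: inv_coord_def Re_divide power2_eq_square)
  then have "w \<in> petal l \<longleftrightarrow> 4 < - l\<^sup>2 * Re w / (norm w)\<^sup>2"
    by (simp add: petal_def)
  also have "\<dots> \<longleftrightarrow> 4 * (norm w)\<^sup>2 + l\<^sup>2 * Re w < 0"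
    using pos_less_divide_eq[of "(norm w)\<^sup>2" 4 "- l\<^sup>2 * Re w"] False by auto
  finally show ?thesis .
qed (auto simp: petal_def inv_coord_def)

text \<open>
  The polynomial form of the condition is needed because \<open>inv_coord\<close> is not continuous at \<open>0\<close>.
\<close>

lemma open_petal: "l \<noteq> 0 \<Longrightarrow> open (petal l)"
proof -
  assume "l \<noteq> 0"
  then have "petal l = {w. 4 * (norm w)\<^sup>2 + l\<^sup>2 * Re w < 0}"
    using petal_iff_disk by blast
  then show ?thesis
    by (simp add: open_Collect_less continuous_intros)
qed

lemma norm_le_1_petal:
  assumes "0 < l" "l \<le> 1" "w \<in> petal l"
  shows "norm w \<le> 1"
proof -
  have "4 * (norm w)\<^sup>2 < l\<^sup>2 * (- Re w)"
    using petal_iff_disk[of l w] assms by simp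
  also have "\<dots> \<le> l\<^sup>2 * norm w"
    using abs_Re_le_cmod[of w] by (intro mult_left_mono) auto
  also have "\<dots> \<le> 1 * norm w"
    using assms by (intro mult_right_mono) (auto simp: power_le_one)
  finally have "norm w * (4 * norm w) < norm w * 1"
    by (simp add: power2_eq_square algebra_simps)
  then have "4 * norm w < 1"
    by (metis mult_less_cancel_left_pos norm_ge_zero mult_zero_left order_less_irrefl order_le_less)
  then show ?thesis by simp
qed

lemma inv_coord_quad_f:
  assumes "l \<noteq> 0" "w \<noteq> 0" "inv_coord l w \<noteq> of_real l"
  shows "inv_coord l (quad_f l w) = inv_coord l w / of_real l + 1 + of_real l / (inv_coord l w - of_real l)"
proof -
  have "of_real l + w \<noteq> 0"
    using assms by (auto simp: inv_coord_def field_simps power2_eq_square add_eq_0_iff)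
  define c where "c = complex_of_real l"
  have c: "c \<noteq> 0" "c + w \<noteq> 0"
    using \<open>of_real l + w \<noteq> 0\<close> assms(1) by (auto simp: c_def)
  have "- c\<^sup>2 / w - c = - c * (c + w) / w"
    using assms(2) by (simp add: field_simps power2_eq_square)
  moreover have "c / (- c * (c + w) / w) = - w / (c + w)"
    using c assms(2) by simp
  ultimately have "c / (- c\<^sup>2 / w - c) = - w / (c + w)"
    by (simp only:)
  moreover have "- c\<^sup>2 / (w * (c + w)) = - c / w + 1 + - w / (c + w)"
    using c assms(2) by (simp add: divide_simps) (simp add: algebra_simps power2_eq_square)
  moreover have "(- c\<^sup>2 / w) / c = - c / w"
    using c by (simp add: power2_eq_square)
  moreover have "quad_f l w = w * (c + w)"
    by (simp add: quad_f_def c_def power2_eq_square algebra_simps)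
  ultimately show ?thesis
    by (simp add: inv_coord_def c_def)
qed

lemma norm_diff_of_real_ge:
  "x \<le> Re Z \<Longrightarrow> l \<le> 1 \<Longrightarrow> x - 1 \<le> norm (Z - of_real l)"
  using abs_Re_le_cmod[of "Z - of_real l"] by simp

lemma petal_step:
  assumes l: "1/2 \<le> l" "l \<le> 1" and w: "w \<in> petal l"
  shows "inv_coord l (quad_f l w) = inv_coord l w / of_real l + 1 + of_real l / (inv_coord l w - of_real l)"
    and "Re (inv_coord l w) + 1/2 \<le> Re (inv_coord l (quad_f l w))"
    and "quad_f l w \<in> petal l"
proof -
  have Z: "4 < Re (inv_coord l w)" using w by (simp add: petal_def)
  show eq: "inv_coord l (quad_f l w) = inv_coord l w / of_real l + 1 + of_real l / (inv_coord l w - of_real l)"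
    using l Z petal_nonzero[OF w] by (intro inv_coord_quad_f) auto
  have n3: "3 \<le> norm (inv_coord l w - of_real l)"
    using norm_diff_of_real_ge[of 4 "inv_coord l w" l] Z l by simp
  have "norm (of_real l / (inv_coord l w - of_real l)) \<le> 1 / 3"
    unfolding norm_divide using n3 l by (intro frac_le) auto
  then have "- (1/3) \<le> Re (of_real l / (inv_coord l w - of_real l))"
    using abs_Re_le_cmod[of "of_real l / (inv_coord l w - of_real l)"] by linarith
  moreover have "Re (inv_coord l w) \<le> Re (inv_coord l w / of_real l)"
    using l Z by (simp add: pos_le_divide_eq mult_left_le)
  ultimately show ge: "Re (inv_coord l w) + 1/2 \<le> Re (inv_coord l (quad_f l w))"
    unfolding eq by simp
  show "quad_f l w \<in> petal l"
    using ge Z by (simp add: petal_def)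
qed

lemma petal_iterate:
  assumes l: "1/2 \<le> l" "l \<le> 1" and w: "w \<in> petal l"
  shows "(quad_f l ^^ n) w \<in> petal l" and "4 + n / 2 \<le> Re (inv_coord l ((quad_f l ^^ n) w))"
proof -
  have "(quad_f l ^^ n) w \<in> petal l \<and> 4 + n / 2 \<le> Re (inv_coord l ((quad_f l ^^ n) w))"
  proof (induction n)
    case 0
    then show ?case using w by (simp add: petal_def)
  next
    case (Suc n)
    then show ?case
      using petal_step[OF l, of "(quad_f l ^^ n) w"] by (auto simp: field_simps)
  qed
  then show "(quad_f l ^^ n) w \<in> petal l" "4 + n / 2 \<le> Re (inv_coord l ((quad_f l ^^ n) w))"
    by auto
qed

lemma filled_julia_funpow:
  assumes "(p ^^ N) w \<in> filled_julia p"
  shows "w \<in> filled_julia p"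
proof -
  have "range (\<lambda>n. (p ^^ n) w) \<subseteq> (\<lambda>n. (p ^^ n) w) ` {..<N} \<union> range (\<lambda>n. (p ^^ n) ((p ^^ N) w))"
  proof
    fix y assume "y \<in> range (\<lambda>n. (p ^^ n) w)"
    then obtain n where n: "y = (p ^^ n) w" by auto
    show "y \<in> (\<lambda>n. (p ^^ n) w) ` {..<N} \<union> range (\<lambda>n. (p ^^ n) ((p ^^ N) w))"
    proof (cases "n < N")
      case False
      then have "y = (p ^^ (n - N)) ((p ^^ N) w)"
        using n funpow_add[of "n - N" N p] by simp
      then show ?thesis by blast
    qed (use n in auto)
  qed
  moreover have "bounded ((\<lambda>n. (p ^^ n) w) ` {..<N} \<union> range (\<lambda>n. (p ^^ n) ((p ^^ N) w)))"
    using assms by (auto simp: filled_julia_def finite_imp_bounded)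
  ultimately show ?thesis
    unfolding filled_julia_def using bounded_subset by blast
qed

lemma filled_julia_image: "w \<in> filled_julia p \<Longrightarrow> p w \<in> filled_julia p"
proof -
  assume "w \<in> filled_julia p"
  moreover have "range (\<lambda>n. (p ^^ n) (p w)) \<subseteq> range (\<lambda>n. (p ^^ n) w)"
    by (metis (no_types, lifting) comp_apply funpow_Suc_right image_subset_iff rangeI)
  ultimately show ?thesis
    unfolding filled_julia_def using bounded_subset by blast
qed

lemma continuous_on_iterate_quad_f:
  "continuous_on S (\<lambda>x. (quad_f (fst x) ^^ n) (snd x))"
  by (induction n) (auto simp: quad_f_def intro!: continuous_intros)

lemma holomorphic_on_iterate_quad_f: "(quad_f l ^^ n) holomorphic_on S"
  by (induction n) (auto simp: quad_f_def o_def id_def intro!: holomorphic_intros)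

lemma petal_absorbs_imp_interior:
  assumes l: "1/2 \<le> l" "l \<le> 1" and w: "(quad_f l ^^ N) w \<in> petal l"
  shows "w \<in> interior (filled_julia (quad_f l))"
proof (rule interiorI)
  show "open ((quad_f l ^^ N) -` petal l)"
    using l open_petal[of l] holomorphic_on_imp_continuous_on[OF holomorphic_on_iterate_quad_f[where l = l and n = N and S = UNIV]]
    by (simp add: open_vimage)
  show "(quad_f l ^^ N) -` petal l \<subseteq> filled_julia (quad_f l)"
  proof
    fix v assume "v \<in> (quad_f l ^^ N) -` petal l"
    then have "(quad_f l ^^ n) ((quad_f l ^^ N) v) \<in> petal l" for n
      using petal_iterate(1)[OF l] by simp
    then have "norm ((quad_f l ^^ n) ((quad_f l ^^ N) v)) \<le> 1" for n
      using norm_le_1_petal[of l] l by simp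
    then have "(quad_f l ^^ N) v \<in> filled_julia (quad_f l)"
      by (auto simp: filled_julia_def bounded_iff)
    then show "v \<in> filled_julia (quad_f l)"
      by (rule filled_julia_funpow)
  qed
qed (use w in auto)

text \<open>
  The image of the interior is open, and it is contained in the filled Julia set.
\<close>

lemma quad_f_maps_interior:
  assumes w: "w \<in> interior (filled_julia (quad_f l))"
  shows "quad_f l w \<in> interior (filled_julia (quad_f l))"
proof -
  let ?U = "interior (filled_julia (quad_f l))"
  have "open (quad_f l ` ?U)"
  proof (rule open_mapping_thm2[where S = UNIV])
    show "quad_f l holomorphic_on UNIV"
      using holomorphic_on_iterate_quad_f[where l = l and n = 1 and S = UNIV] by simp
    fix X :: "complex set" assume X: "open X" "X \<noteq> {}"
    show "\<not> quad_f l constant_on X"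
    proof
      assume "quad_f l constant_on X"
      then obtain c where c: "\<And>x. x \<in> X \<Longrightarrow> quad_f l x = c" by (auto simp: constant_on_def)
      obtain x0 where x0: "x0 \<in> X" using X by blast
      have "x = x0 \<or> x = - of_real l - x0" if "x \<in> X" for x
      proof -
        have "(x - x0) * (of_real l + x + x0) = 0"
          using c[OF that] c[OF x0] by (simp add: quad_f_def algebra_simps power2_eq_square)
        then have "x - x0 = 0 \<or> of_real l + x + x0 = 0" by (simp only: mult_eq_0_iff)
        then show ?thesis by (auto simp: algebra_simps eq_neg_iff_add_eq_0)
      qed
      then have "X \<subseteq> {x0, - of_real l - x0}" by blast
      then have "finite X" by (rule finite_subset) simp
      then show False using X finite_imp_not_open by blast
    qed
  qed auto
  moreover have "quad_f l ` ?U \<subseteq> filled_julia (quad_f l)"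
    using filled_julia_image interior_subset by blast
  ultimately show ?thesis
    using w by (intro interiorI[of "quad_f l ` ?U"]) auto
qed

lemma iterate_quad_f_interior:
  "w \<in> interior (filled_julia (quad_f l)) \<Longrightarrow> (quad_f l ^^ n) w \<in> interior (filled_julia (quad_f l))"
  by (induction n) (auto intro: quad_f_maps_interior)

section \<open>Orbits in the interior of the parabolic filled Julia set\<close>

lemma norm_le_2_filled_julia:
  assumes w: "w \<in> filled_julia (quad_f 1)"
  shows "norm w \<le> 2"
proof (rule ccontr)
  assume "\<not> norm w \<le> 2"
  define c where "c = norm w - 1"
  have c: "1 < c" using \<open>\<not> norm w \<le> 2\<close> by (simp add: c_def)
  have "c ^ n * norm w \<le> norm ((quad_f 1 ^^ n) w)" for n
  proof (induction n)
    case (Suc n)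
    let ?v = "(quad_f 1 ^^ n) w"
    have "1 * norm w \<le> c ^ n * norm w"
      using c by (intro mult_right_mono) (auto simp: one_le_power)
    then have "norm w \<le> norm ?v" using Suc by linarith
    then have "c \<le> norm (1 + ?v)"
      using norm_triangle_ineq2[of ?v "- 1"] by (simp add: c_def add.commute)
    then have "c * (c ^ n * norm w) \<le> norm (1 + ?v) * norm ?v"
      using Suc c by (intro mult_mono) auto
    also have "\<dots> = norm (quad_f 1 ?v)"
      by (simp add: quad_f_def power2_eq_square algebra_simps flip: norm_mult)
    finally show ?case by (simp add: mult.assoc)
  qed simp
  moreover obtain B where B: "\<And>n. norm ((quad_f 1 ^^ n) w) \<le> B"
    using w by (auto simp: filled_julia_def bounded_iff)
  moreover obtain n where "B < c ^ n"
    using real_arch_pow[OF c] by blast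
  moreover have "c ^ n * 1 \<le> c ^ n * norm w"
    using c by (intro mult_left_mono) (auto simp: c_def)
  ultimately show False
    by (metis mult.right_neutral not_less order_trans)
qed

lemma positive_real_escapes:
  assumes x: "0 < x"
  shows "of_real x \<notin> filled_julia (quad_f 1)"
proof
  assume "of_real x \<in> filled_julia (quad_f 1)"
  then have K: "(quad_f 1 ^^ n) (of_real x) \<in> filled_julia (quad_f 1)" for n
    by (induction n) (auto intro: filled_julia_image)
  have iter: "\<exists>y. (quad_f 1 ^^ n) (of_real x) = of_real y \<and> x + n * x\<^sup>2 \<le> y" for n :: nat
  proof (induction n)
    case (Suc n)
    then obtain y where y: "(quad_f 1 ^^ n) (of_real x) = of_real y" "x + n * x\<^sup>2 \<le> y"
      by blast
    have "x \<le> y" using y(2) by (smt (verit) of_nat_0_le_iff zero_le_power2 mult_nonneg_nonneg)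
    then have "x\<^sup>2 \<le> y\<^sup>2" using x by (intro power_mono) auto
    then have "x + real (Suc n) * x\<^sup>2 \<le> y + y\<^sup>2"
      using y(2) by (simp add: algebra_simps)
    moreover have "(quad_f 1 ^^ Suc n) (of_real x) = of_real (y + y\<^sup>2)"
      using y(1) by (simp add: quad_f_def)
    ultimately show ?case by blast
  qed auto
  obtain n :: nat where "2 < n * x\<^sup>2"
    using ex_less_of_nat_mult[of "x\<^sup>2" 2] x by auto
  moreover obtain y where "(quad_f 1 ^^ n) (of_real x) = of_real y" "x + n * x\<^sup>2 \<le> y"
    using iter by blast
  moreover have "\<bar>y\<bar> \<le> 2"
    using norm_le_2_filled_julia[OF K[of n]] calculation(2) by simp
  ultimately show False using x by linarith
qed

text \<open>
  Together with forward invariance this says that no orbit in the interior hits the parabolic point.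
\<close>

lemma zero_not_in_interior: "0 \<notin> interior (filled_julia (quad_f 1))"
proof
  assume "0 \<in> interior (filled_julia (quad_f 1))"
  then obtain e where e: "e > 0" "ball 0 e \<subseteq> filled_julia (quad_f 1)"
    by (auto simp: mem_interior)
  then have "of_real (e/2) \<in> filled_julia (quad_f 1)"
    by (auto simp: subset_iff)
  then show False using positive_real_escapes[of "e/2"] e by simp
qed

text \<open>
  The iterates map the filled Julia set into the disk of radius \<open>2\<close>, so Cauchy's inequality applies to all of
  them with the same constant.
\<close>

lemma deriv_iterate_bounded:
  assumes r: "0 < r" and sub: "ball w r \<subseteq> filled_julia (quad_f 1)"
  shows "norm (\<Prod>k<n. 1 + 2 * (quad_f 1 ^^ k) w) \<le> 4 / r"
proof -
  have "((quad_f 1 ^^ n) has_field_derivative (\<Prod>k<n. 1 + 2 * (quad_f 1 ^^ k) w)) (at w)"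
  proof (induction n)
    case (Suc n)
    have "(quad_f 1 has_field_derivative (1 + 2 * v)) (at v)" for v
      unfolding quad_f_def by (auto intro!: derivative_eq_intros)
    from DERIV_chain[OF this Suc] show ?case
      by (simp add: mult.commute o_def)
  qed (simp add: id_def)
  then have "deriv (quad_f 1 ^^ n) w = (\<Prod>k<n. 1 + 2 * (quad_f 1 ^^ k) w)"
    by (rule DERIV_imp_deriv)
  moreover have "norm ((deriv ^^ 1) (quad_f 1 ^^ n) w) \<le> fact 1 * 2 / (r / 2) ^ 1"
  proof (rule Cauchy_inequality)
    show "continuous_on (cball w (r / 2)) (quad_f 1 ^^ n)"
      by (rule holomorphic_on_imp_continuous_on) (rule holomorphic_on_iterate_quad_f)
    show "norm ((quad_f 1 ^^ n) x) \<le> 2" if "norm (w - x) = r / 2" for x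
    proof -
      have "x \<in> filled_julia (quad_f 1)"
        using sub that r by (auto simp: dist_norm subset_iff)
      then have "(quad_f 1 ^^ n) x \<in> filled_julia (quad_f 1)"
        by (induction n) (auto intro: filled_julia_image)
      then show ?thesis by (rule norm_le_2_filled_julia)
    qed
  qed (use r holomorphic_on_iterate_quad_f in auto)
  ultimately show ?thesis by simp
qed

text \<open>
  Write \<open>x = Re w + 1/2\<close> and \<open>y = Im w\<close>. Then \<open>y\<close> is multiplied by \<open>2 x\<close> in one step, while the derivative
  of the iterate is multiplied by \<open>2 (x + \<i> y)\<close>. So \<open>g\<close> expands the metric \<open>\<bar>dw\<bar> / \<bar>Im w\<bar>\<close>, by the
  factor \<open>sqrt (x\<^sup>2 + y\<^sup>2) / \<bar>x\<bar>\<close>, and the quotient \<open>t\<close> of \<open>\<bar>y\<bar>\<close> by the modulus of the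
  derivative decreases. As the derivatives are bounded, either \<open>t\<close> tends to \<open>0\<close> and \<open>y\<close> with it, or \<open>t\<close> has
  a positive limit, the factors tend to \<open>1\<close>, and again \<open>y\<close> tends to \<open>0\<close>.
\<close>

lemma Im_iterate_tendsto_0:
  assumes w: "w \<in> interior (filled_julia (quad_f 1))"
  shows "(\<lambda>n. Im ((quad_f 1 ^^ n) w)) \<longlonglongrightarrow> 0"
proof -
  define v where "v n = (quad_f 1 ^^ n) w" for n
  define x where "x n = Re (v n) + 1/2" for n
  define y where "y n = Im (v n)" for n
  define d where "d n = norm (\<Prod>k<n. 1 + 2 * v k)" for n
  obtain r where r: "r > 0" "ball w r \<subseteq> filled_julia (quad_f 1)"
    using w by (auto simp: mem_interior)
  have d_le: "d n \<le> 4 / r" for n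
    unfolding d_def v_def by (rule deriv_iterate_bounded[OF r])
  have y_Suc: "y (Suc n) = 2 * x n * y n" for n
    by (simp add: y_def x_def v_def quad_f_def power2_eq_square algebra_simps)
  have nrm: "norm (1 + 2 * v n) = 2 * sqrt ((x n)\<^sup>2 + (y n)\<^sup>2)" for n
  proof -
    have "1 + 2 * v n = 2 * Complex (x n) (y n)"
      by (simp add: complex_eq_iff x_def y_def)
    then show ?thesis by (simp add: norm_mult complex_norm)
  qed
  have d_Suc: "d (Suc n) = d n * (2 * sqrt ((x n)\<^sup>2 + (y n)\<^sup>2))" for n
    unfolding nrm[symmetric] by (simp add: d_def norm_mult)
  have "y \<longlonglongrightarrow> 0"
  proof (cases "\<exists>m. y m = 0")
    case True
    then obtain m where "y m = 0" by blast
    then have "y (m + k) = 0" for k by (induction k) (auto simp: y_Suc)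
    then have "\<forall>\<^sub>F n in sequentially. y n = 0"
      unfolding eventually_sequentially using le_Suc_ex by blast
    then show ?thesis by (rule tendsto_eventually)
  next
    case False
    then have y0: "y n \<noteq> 0" for n by blast
    have x0: "x n \<noteq> 0" for n using y_Suc[of n] y0[of "Suc n"] by auto
    have sq: "0 < (x n)\<^sup>2 + (y n)\<^sup>2" for n using y0[of n] by (simp add: add_nonneg_pos)
    have d0: "0 < d n" for n
    proof (induction n)
      case (Suc n)
      then show ?case unfolding d_Suc using sq[of n] by simp
    qed (simp add: d_def)
    define t where "t n = \<bar>y n\<bar> / d n" for n
    define q where "q n = \<bar>x n\<bar> / sqrt ((x n)\<^sup>2 + (y n)\<^sup>2)" for n
    have t_pos: "0 < t n" for n using y0 d0 by (simp add: t_def)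
    have t_Suc: "t (Suc n) = t n * q n" for n
      using d0[of n] sq[of n] by (simp add: t_def q_def y_Suc d_Suc abs_mult)
    have "q n \<le> 1" for n
      using sq[of n] by (simp add: q_def real_le_rsqrt)
    then have "decseq t"
      using t_pos by (intro decseq_SucI) (simp add: t_Suc mult_left_le less_imp_le)
    then obtain T where T: "t \<longlonglongrightarrow> T"
      using decseq_convergent[of t 0] t_pos less_imp_le by metis
    show ?thesis
    proof (cases "T = 0")
      case True
      have "\<bar>y n\<bar> \<le> t n * (4 / r)" for n
        using mult_left_mono[OF d_le[of n], of "t n"] t_pos[of n] d0[of n] by (simp add: t_def)
      moreover have "(\<lambda>n. t n * (4 / r)) \<longlonglongrightarrow> 0"
        using tendsto_mult_right[OF T, of "4/r"] True by simp
      ultimately show ?thesis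
        by (intro Lim_null_comparison[of y]) auto
    next
      case False
      have "(\<lambda>n. t (Suc n) / t n) \<longlonglongrightarrow> T / T"
        by (intro tendsto_divide LIMSEQ_Suc T False)
      then have "q \<longlonglongrightarrow> 1"
        using t_pos False by (simp add: t_Suc less_imp_neq[THEN not_sym])
      then have lim: "(\<lambda>n. (1 - (q n)\<^sup>2) * 16) \<longlonglongrightarrow> 0"
        by (auto intro!: tendsto_eq_intros)
      have "(y n)\<^sup>2 \<le> (1 - (q n)\<^sup>2) * 16" for n
      proof -
        have "(q n)\<^sup>2 * ((x n)\<^sup>2 + (y n)\<^sup>2) = (x n)\<^sup>2"
          using sq[of n] by (simp add: q_def power_divide)
        then have "(y n)\<^sup>2 = (1 - (q n)\<^sup>2) * ((x n)\<^sup>2 + (y n)\<^sup>2)"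
          by (simp only: left_diff_distrib) simp
        moreover have "0 \<le> 1 - (q n)\<^sup>2"
          using \<open>q n \<le> 1\<close> by (simp add: q_def power_le_one)
        moreover have "(x n)\<^sup>2 + (y n)\<^sup>2 \<le> 16"
        proof -
          have "v n \<in> filled_julia (quad_f 1)"
            unfolding v_def using iterate_quad_f_interior[OF w] interior_subset by blast
          then have "norm (v n) \<le> 2" by (rule norm_le_2_filled_julia)
          then have "2 * sqrt ((x n)\<^sup>2 + (y n)\<^sup>2) \<le> 5"
            using norm_triangle_ineq[of 1 "2 * v n"] by (simp add: nrm norm_mult)
          then have "sqrt ((x n)\<^sup>2 + (y n)\<^sup>2) \<le> 4" by linarith
          then show ?thesis using real_sqrt_le_iff[of "(x n)\<^sup>2 + (y n)\<^sup>2" 16] by simp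
        qed
        ultimately show ?thesis by (metis mult_left_mono)
      qed
      then have "(\<lambda>n. (y n)\<^sup>2) \<longlonglongrightarrow> 0"
        by (intro Lim_null_comparison[OF _ lim]) auto
      then show ?thesis
        using tendsto_real_sqrt[of "\<lambda>n. (y n)\<^sup>2" 0] by (simp add: tendsto_rabs_zero_iff)
    qed
  qed
  then show ?thesis unfolding y_def v_def .
qed

text \<open>
  An accumulation point \<open>p\<close> is real by the previous lemma, is not positive because positive reals escape, and
  is at least \<open>- 1/3\<close> because \<open>Re (g w) \<ge> - 1/4 - (Im w)\<^sup>2\<close>. On the interval \<open>[-1/3, 0)\<close> one step of \<open>g\<close> leads into
  the petal.
\<close>

lemma interior_accumulation_enters_petal:
  assumes w: "w \<in> interior (filled_julia (quad_f 1))"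
    and s: "strict_mono s" and p: "(\<lambda>k. (quad_f 1 ^^ s k) w) \<longlonglongrightarrow> p" and "p \<noteq> 0"
  shows "\<exists>n. (quad_f 1 ^^ n) w \<in> petal 1"
proof -
  define v where "v n = (quad_f 1 ^^ n) w" for n
  have v_Suc: "v (Suc n) = quad_f 1 (v n)" for n by (simp add: v_def)
  have vK: "v n \<in> filled_julia (quad_f 1)" for n
    unfolding v_def using iterate_quad_f_interior[OF w] interior_subset by blast
  have p: "(\<lambda>k. v (s k)) \<longlonglongrightarrow> p" using p by (simp add: v_def)
  have y: "(\<lambda>n. Im (v n)) \<longlonglongrightarrow> 0"
    using Im_iterate_tendsto_0[OF w] by (simp add: v_def)
  have "(\<lambda>k. Im (v (s k))) \<longlonglongrightarrow> 0"
    using LIMSEQ_subseq_LIMSEQ[OF y s] by (simp add: o_def)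
  then have "Im p = 0"
    using tendsto_Im[OF p] LIMSEQ_unique by blast
  then obtain q where q: "p = of_real q"
    by (metis complex_is_Real_iff Reals_cases)
  have "p \<in> filled_julia (quad_f 1)"
  proof -
    have "norm ((quad_f 1 ^^ m) p) \<le> 2" for m
    proof -
      have "isCont (quad_f 1 ^^ m) p"
        using holomorphic_on_imp_continuous_on[OF holomorphic_on_iterate_quad_f[where S = UNIV]]
        by (simp add: continuous_on_eq_continuous_at)
      then have "(\<lambda>k. (quad_f 1 ^^ m) (v (s k))) \<longlonglongrightarrow> (quad_f 1 ^^ m) p"
        using isCont_tendsto_compose p by blast
      moreover have "norm ((quad_f 1 ^^ m) (v (s k))) \<le> 2" for k
        using norm_le_2_filled_julia[OF vK[of "m + s k"]] by (simp add: v_def funpow_add)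
      ultimately show ?thesis
        by (intro Lim_norm_ubound[of sequentially]) auto
    qed
    then show ?thesis by (auto simp: filled_julia_def bounded_iff)
  qed
  then have "q \<le> 0" using positive_real_escapes[of q] q by force
  then have q_neg: "q < 0" using q \<open>p \<noteq> 0\<close> by (cases "q = 0") auto
  have q_ge: "- 1/3 \<le> q"
  proof -
    have "(\<lambda>n. - 1/4 - (Im (v n))\<^sup>2) \<longlonglongrightarrow> - 1/4 - 0\<^sup>2"
      by (intro tendsto_intros y)
    then have "\<forall>\<^sub>F n in sequentially. - 1/3 < - 1/4 - (Im (v n))\<^sup>2"
      by (rule order_tendstoD) simp
    moreover have "- 1/4 - (Im (v n))\<^sup>2 \<le> Re (v (Suc n))" for n
    proof -
      have "0 \<le> (Re (v n) + 1/2)\<^sup>2" by simp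
      then show ?thesis
        by (simp add: v_Suc quad_f_def power2_eq_square algebra_simps)
    qed
    ultimately have "\<forall>\<^sub>F n in sequentially. - 1/3 \<le> Re (v (Suc n))"
      by (auto elim!: eventually_mono) (meson less_imp_le order_less_le_trans)
    then have "\<forall>\<^sub>F n in sequentially. - 1/3 \<le> Re (v n)"
      by (rule eventually_sequentially_Suc[THEN iffD1])
    then have "\<forall>\<^sub>F k in sequentially. - 1/3 \<le> Re (v (s k))"
      using eventually_subseq[OF s] by blast
    then show ?thesis
      using tendsto_lowerbound[OF tendsto_Re[OF p]] q by simp
  qed
  have "quad_f 1 p \<in> petal 1"
  proof -
    define u where "u = q + q\<^sup>2"
    have "u = q * (1 + q)" by (simp add: u_def power2_eq_square algebra_simps)
    then have u: "u < 0" "- 1/4 < u"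
    proof -
      show "u < 0" using \<open>u = q * (1 + q)\<close> q_neg q_ge by (simp add: mult_neg_pos)
      have "0 < (q + 1/2)\<^sup>2" using q_ge by (intro zero_less_power) simp
      then show "- 1/4 < u" by (simp add: u_def power2_eq_square algebra_simps)
    qed
    have "4 * u\<^sup>2 + u = u * (4 * u + 1)" by (simp add: power2_eq_square algebra_simps)
    also have "\<dots> < 0" using u by (intro mult_neg_pos) auto
    finally show ?thesis
      using petal_iff_disk[of 1 "of_real u"] q by (simp add: quad_f_def u_def flip: of_real_power of_real_add)
  qed
  moreover have "(\<lambda>k. quad_f 1 (v (s k))) \<longlonglongrightarrow> quad_f 1 p"
    unfolding quad_f_def by (intro tendsto_intros p)
  ultimately have "\<forall>\<^sub>F k in sequentially. quad_f 1 (v (s k)) \<in> petal 1"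
    using topological_tendstoD open_petal[of 1] by fastforce
  then obtain k where "quad_f 1 (v (s k)) \<in> petal 1"
    by (auto simp: eventually_sequentially)
  then show ?thesis by (metis v_Suc v_def)
qed

text \<open>
  Near infinity the real part of \<open>Z\<close> increases by at least \<open>1/2\<close> in each step, whatever the direction in which
  the orbit approaches.
\<close>

lemma tendsto_0_enters_petal:
  assumes nz: "\<And>n. (quad_f 1 ^^ n) w \<noteq> 0" and lim: "(\<lambda>n. (quad_f 1 ^^ n) w) \<longlonglongrightarrow> 0"
  shows "\<exists>n. (quad_f 1 ^^ n) w \<in> petal 1"
proof -
  define Z where "Z n = inv_coord 1 ((quad_f 1 ^^ n) w)" for n
  have "\<forall>\<^sub>F n in sequentially. norm ((quad_f 1 ^^ n) w) < 1/3"
    using order_tendstoD(2)[OF tendsto_norm[OF lim], of "1/3"] by simp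
  then obtain N where N: "\<And>n. n \<ge> N \<Longrightarrow> norm ((quad_f 1 ^^ n) w) < 1/3"
    by (auto simp: eventually_sequentially)
  have big: "3 < norm (Z n)" if "n \<ge> N" for n
    using N[OF that] nz[of n] by (simp add: Z_def inv_coord_def norm_divide field_simps)
  have step: "Re (Z n) + 1/2 \<le> Re (Z (Suc n))" if "n \<ge> N" for n
  proof -
    have n2: "2 \<le> norm (Z n - 1)"
      using big[OF that] norm_triangle_ineq2[of "Z n" 1] by simp
    have "Z (Suc n) = Z n + 1 + 1 / (Z n - 1)"
    proof -
      have "Z n \<noteq> 1" using n2 by auto
      then show ?thesis
        using inv_coord_quad_f[of 1 "(quad_f 1 ^^ n) w"] nz by (simp add: Z_def)
    qed
    moreover have "norm (1 / (Z n - 1)) \<le> 1 / 2"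
      unfolding norm_divide using n2 by (intro frac_le) auto
    then have "- (1/2) \<le> Re (1 / (Z n - 1))"
      using abs_Re_le_cmod[of "1 / (Z n - 1)"] by linarith
    ultimately show ?thesis by simp
  qed
  have grow: "Re (Z N) + k / 2 \<le> Re (Z (N + k))" for k :: nat
  proof (induction k)
    case (Suc k)
    then show ?case using step[of "N + k"] by (simp add: field_simps)
  qed simp
  obtain k :: nat where "2 * (4 - Re (Z N)) < k"
    using reals_Archimedean2 by blast
  then have "4 < Re (Z N) + k / 2" by (simp add: field_simps)
  with grow[of k] have "4 < Re (Z (N + k))" by (rule order_less_le_trans[rotated])
  then show ?thesis by (auto simp: petal_def Z_def)
qed

lemma interior_enters_petal:
  assumes w: "w \<in> interior (filled_julia (quad_f 1))"
  shows "\<exists>n. (quad_f 1 ^^ n) w \<in> petal 1"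
proof (cases "(\<lambda>n. (quad_f 1 ^^ n) w) \<longlonglongrightarrow> 0")
  case True
  show ?thesis
  proof (rule tendsto_0_enters_petal[OF _ True])
    show "(quad_f 1 ^^ n) w \<noteq> 0" for n
      using iterate_quad_f_interior[OF w, of n] zero_not_in_interior by metis
  qed
next
  case False
  define v where "v n = (quad_f 1 ^^ n) w" for n
  obtain e where e: "e > 0" "\<not> (\<forall>\<^sub>F n in sequentially. norm (v n) < e)"
    using False unfolding tendsto_iff by (auto simp: v_def)
  then have "infinite {n. e \<le> norm (v n)}"
    by (auto simp: frequently_cofinite[symmetric] cofinite_eq_sequentially not_eventually not_less)
  then obtain r :: "nat \<Rightarrow> nat" where r: "strict_mono r" "\<And>n. e \<le> norm (v (r n))"
    using infinite_enumerate by blast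
  have "v n \<in> cball 0 2" for n
    unfolding v_def using iterate_quad_f_interior[OF w, of n] interior_subset norm_le_2_filled_julia
    by (auto simp: subset_iff)
  then obtain p s where s: "strict_mono (s :: nat \<Rightarrow> nat)" "((\<lambda>n. v (r n)) \<circ> s) \<longlonglongrightarrow> p"
    using compact_imp_seq_compact[OF compact_cball[of "0::complex" 2]]
    by (metis (no_types, lifting) seq_compactE)
  have "e \<le> norm p"
    using Lim_norm_lbound[OF _ s(2)] r(2) by auto
  then have "p \<noteq> 0" using e by auto
  then show ?thesis
    using interior_accumulation_enters_petal[OF w strict_mono_o[OF r(1) s(1)], of p] s(2)
    by (simp add: v_def o_def)
qed

section \<open>Scaled differences of orbits\<close>

context
  fixes l :: real and w w' :: complex
  assumes l: "1/2 \<le> l" "l \<le> 1" and w: "w \<in> petal l" and w': "w' \<in> petal l"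
begin

private definition A :: "nat \<Rightarrow> complex" where
  "A n = of_real l ^ n * (inv_coord l ((quad_f l ^^ n) w) - inv_coord l ((quad_f l ^^ n) w'))"

text \<open>
  The affine part of the map leaves the scaled difference unchanged, and what remains is the difference of
  \<open>l / (Z - l)\<close> at two points whose real parts are at least \<open>4 + n / 2\<close>.
\<close>

lemma scaled_difference_step: "norm (A (Suc n) - A n) \<le> norm (A n) * (4 / (real n + 6)\<^sup>2)"
proof -
  define c where "c = complex_of_real l"
  define Z where "Z = inv_coord l ((quad_f l ^^ n) w)"
  define Y where "Y = inv_coord l ((quad_f l ^^ n) w')"
  have c: "c \<noteq> 0" using l by (simp add: c_def)
  have Z: "(real n + 6) / 2 \<le> norm (Z - c)"
    using norm_diff_of_real_ge[OF petal_iterate(2)[OF l w, of n] l(2)] by (simp add: Z_def c_def field_simps)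
  have Y: "(real n + 6) / 2 \<le> norm (Y - c)"
    using norm_diff_of_real_ge[OF petal_iterate(2)[OF l w', of n] l(2)] by (simp add: Y_def c_def field_simps)
  have nz: "Z - c \<noteq> 0" "Y - c \<noteq> 0" using Z Y by auto
  have "A (Suc n) = c ^ Suc n * ((Z / c + 1 + c / (Z - c)) - (Y / c + 1 + c / (Y - c)))"
    using petal_step(1)[OF l petal_iterate(1)[OF l w, of n]]
      petal_step(1)[OF l petal_iterate(1)[OF l w', of n]]
    by (simp add: A_def c_def Z_def Y_def)
  also have "(Z / c + 1 + c / (Z - c)) - (Y / c + 1 + c / (Y - c))
      = (Z - Y) / c - c * (Z - Y) / ((Z - c) * (Y - c))"
  proof -
    have "c / (Z - c) - c / (Y - c) = - (c * (Z - Y) / ((Z - c) * (Y - c)))"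
      using nz by (simp add: diff_frac_eq) (simp add: algebra_simps minus_divide_left)
    then show ?thesis by (simp add: diff_divide_distrib algebra_simps)
  qed
  also have "c ^ Suc n * \<dots> = c ^ n * (Z - Y) - c ^ n * (Z - Y) * (c\<^sup>2 / ((Z - c) * (Y - c)))"
  proof -
    have "c ^ Suc n * (d / c - c * d / e) = c ^ n * d - c ^ n * d * (c\<^sup>2 / e)" for d e
      using c by (simp add: right_diff_distrib power2_eq_square)
    then show ?thesis .
  qed
  finally have "A (Suc n) - A n = - (A n * (c\<^sup>2 / ((Z - c) * (Y - c))))"
    by (simp add: A_def c_def Z_def Y_def)
  then have "norm (A (Suc n) - A n) = norm (A n) * norm (c\<^sup>2 / ((Z - c) * (Y - c)))"
    by (simp add: norm_mult norm_divide)
  also have "\<dots> \<le> norm (A n) * (4 / (real n + 6)\<^sup>2)"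
  proof (rule mult_left_mono)
    have "norm (c\<^sup>2 / ((Z - c) * (Y - c))) = l\<^sup>2 / (norm (Z - c) * norm (Y - c))"
      by (simp add: c_def norm_divide norm_mult norm_power)
    also have "\<dots> \<le> 1 / (((real n + 6) / 2) * ((real n + 6) / 2))"
      using l Z Y by (intro frac_le mult_mono) (auto simp: power_le_one)
    also have "\<dots> = 4 / (real n + 6)\<^sup>2"
      by (simp add: power2_eq_square)
    finally show "norm (c\<^sup>2 / ((Z - c) * (Y - c))) \<le> 4 / (real n + 6)\<^sup>2" .
  qed simp
  finally show ?thesis .
qed

text \<open>
  The factors \<open>1 + 4 / (n + 6)\<^sup>2\<close> have a convergent product; the fraction is a telescoping majorant of their
  partial products.
\<close>

lemma scaled_difference_bound: "norm (A n) \<le> 5 * norm (A 0) * ((real n + 1) / (real n + 5))"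
proof (induction n)
  case (Suc n)
  have "norm (A (Suc n)) \<le> norm (A n) + norm (A (Suc n) - A n)"
    using norm_triangle_ineq[of "A n" "A (Suc n) - A n"] by simp
  also have "\<dots> \<le> norm (A n) * (1 + 4 / (real n + 6)\<^sup>2)"
    using scaled_difference_step[of n] by (simp add: algebra_simps)
  also have "\<dots> \<le> 5 * norm (A 0) * ((real n + 1) / (real n + 5)) * (1 + 4 / (real n + 6)\<^sup>2)"
    using Suc by (intro mult_right_mono) auto
  also have "\<dots> = 5 * norm (A 0) * ((real n + 1) / (real n + 5) * (1 + 4 / (real n + 6)\<^sup>2))"
    by (simp only: mult.assoc)
  also have "\<dots> \<le> 5 * norm (A 0) * ((real n + 2) / (real n + 6))"
  proof (rule mult_left_mono)
    have "((real n + 1) * ((real n + 6)\<^sup>2 + 4)) / ((real n + 5) * (real n + 6)\<^sup>2)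
        \<le> ((real n + 2) * ((real n + 5) * (real n + 6))) / ((real n + 5) * (real n + 6)\<^sup>2)"
      by (intro divide_right_mono) (auto simp: power2_eq_square algebra_simps)
    moreover have "(real n + 1) / (real n + 5) * (1 + 4 / (real n + 6)\<^sup>2)
        = ((real n + 1) * ((real n + 6)\<^sup>2 + 4)) / ((real n + 5) * (real n + 6)\<^sup>2)"
    proof -
      have "1 + 4 / (real n + 6)\<^sup>2 = ((real n + 6)\<^sup>2 + 4) / (real n + 6)\<^sup>2"
        by (simp add: add_divide_distrib)
      then show ?thesis by simp
    qed
    moreover have "((real n + 2) * ((real n + 5) * (real n + 6))) / ((real n + 5) * (real n + 6)\<^sup>2)
        = (real n + 2) / (real n + 6)"
      by (simp add: power2_eq_square)
    ultimately show "(real n + 1) / (real n + 5) * (1 + 4 / (real n + 6)\<^sup>2)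
        \<le> (real n + 2) / (real n + 6)"
      by linarith
  qed simp
  finally show ?case by (simp add: add.commute)
qed simp

lemma scaled_difference_increment:
  "norm (of_real l ^ Suc n * (inv_coord l ((quad_f l ^^ Suc n) w) - inv_coord l ((quad_f l ^^ Suc n) w'))
       - of_real l ^ n * (inv_coord l ((quad_f l ^^ n) w) - inv_coord l ((quad_f l ^^ n) w')))
    \<le> 20 * norm (inv_coord l w - inv_coord l w') / (real n + 6)\<^sup>2"
proof -
  have "norm (A n) \<le> 5 * norm (A 0) * 1"
    using mult_left_mono[of "(real n + 1) / (real n + 5)" 1 "5 * norm (A 0)"]
      scaled_difference_bound[of n] by simp
  then have "norm (A (Suc n) - A n) \<le> 5 * norm (A 0) * (4 / (real n + 6)\<^sup>2)"
    using scaled_difference_step[of n] mult_right_mono[of "norm (A n)" "5 * norm (A 0)" "4 / (real n + 6)\<^sup>2"]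
    by simp
  then show ?thesis by (simp add: A_def)
qed

end

lemma inv_coord_continuous_on:
  assumes "continuous_on S f" "continuous_on S g" "\<And>x. x \<in> S \<Longrightarrow> g x \<noteq> 0"
  shows "continuous_on S (\<lambda>x. inv_coord (f x) (g x))"
  unfolding inv_coord_def using assms by (intro continuous_intros) auto

text \<open>
  The increments have a summable majorant that does not depend on the parameter, so the limit is uniform and hence
  continuous on all of \<open>K\<close>, including the part with parameter \<open>1\<close>.
\<close>

lemma scaled_difference_continuous_limit:
  fixes Q :: "real \<times> 'a::metric_space \<Rightarrow> complex" and K
  assumes K: "compact K" and l: "\<And>x. x \<in> K \<Longrightarrow> 1/2 \<le> fst x \<and> fst x \<le> 1"
    and q: "continuous_on K q" "\<And>x. x \<in> K \<Longrightarrow> q x \<in> petal (fst x)"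
    and q': "continuous_on K q'" "\<And>x. x \<in> K \<Longrightarrow> q' x \<in> petal (fst x)"
  obtains L :: "real \<times> 'a \<Rightarrow> complex" where "continuous_on K L"
    "\<And>x. x \<in> K \<Longrightarrow> (\<lambda>n. of_real (fst x) ^ n *
        (inv_coord (fst x) ((quad_f (fst x) ^^ n) (q x)) - inv_coord (fst x) ((quad_f (fst x) ^^ n) (q' x))))
      \<longlonglongrightarrow> L x"
proof -
  define A where "A n x = complex_of_real (fst x) ^ n *
    (inv_coord (fst x) ((quad_f (fst x) ^^ n) (q x)) - inv_coord (fst x) ((quad_f (fst x) ^^ n) (q' x)))"
    for n and x :: "real \<times> 'a"
  have contA: "continuous_on K (A n)" for n
  proof -
    have iter: "continuous_on K (\<lambda>x. (quad_f (fst x) ^^ n) (p x))" if "continuous_on K p" for p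
      using continuous_on_compose[of K "\<lambda>x. (fst x, p x)" "\<lambda>x. (quad_f (fst x) ^^ n) (snd x)"]
        continuous_on_iterate_quad_f that by (simp add: o_def continuous_on_Pair continuous_on_fst)
    have "(quad_f (fst x) ^^ n) (p x) \<noteq> 0" if "x \<in> K" "p x \<in> petal (fst x)" for p x
      using petal_nonzero petal_iterate(1) l that by blast
    then show ?thesis
      unfolding A_def using q q'
      by (intro continuous_intros inv_coord_continuous_on iter) auto
  qed
  obtain B where B: "\<And>x. x \<in> K \<Longrightarrow> norm (A 0 x) \<le> B"
    using compact_imp_bounded[OF compact_continuous_image[OF contA[of 0] K]]
    by (auto simp: bounded_iff)
  have "uniform_limit K (\<lambda>n x. \<Sum>i<n. A (Suc i) x - A i x) (\<lambda>x. \<Sum>i. A (Suc i) x - A i x) sequentially"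
  proof (rule Weierstrass_m_test)
    show "norm (A (Suc n) x - A n x) \<le> 20 * B * inverse ((real (n + 6))\<^sup>2)" if "x \<in> K" for n x
    proof -
      have "norm (A (Suc n) x - A n x) \<le> 20 * norm (A 0 x) / (real n + 6)\<^sup>2"
        unfolding A_def using scaled_difference_increment[of "fst x" "q x" "q' x" n] l q q' that
        by simp
      also have "\<dots> \<le> 20 * B / (real n + 6)\<^sup>2"
        using B[OF that] by (intro divide_right_mono) auto
      finally show ?thesis by (simp add: divide_inverse)
    qed
    have "summable (\<lambda>n. inverse ((real (n + 6))\<^sup>2))"
      using inverse_power_summable[of 2, where ?'a = real]
      by (subst summable_iff_shift[of "\<lambda>n. inverse ((real n)\<^sup>2)" 6]) simp
    then show "summable (\<lambda>n. 20 * B * inverse ((real (n + 6))\<^sup>2))"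
      by (rule summable_mult)
  qed
  moreover have "(\<Sum>i<n. A (Suc i) x - A i x) = A n x - A 0 x" for n x
    by (rule sum_lessThan_telescope[of "\<lambda>i. A i x"])
  ultimately have "uniform_limit K (\<lambda>n x. A n x - A 0 x) (\<lambda>x. \<Sum>i. A (Suc i) x - A i x) sequentially"
    by (simp only:)
  then have "uniform_limit K (\<lambda>n x. A n x - A 0 x + A 0 x)
      (\<lambda>x. (\<Sum>i. A (Suc i) x - A i x) + A 0 x) sequentially"
    by (intro uniform_limit_add uniform_limit_const)
  then have lim: "uniform_limit K A (\<lambda>x. (\<Sum>i. A (Suc i) x - A i x) + A 0 x) sequentially"
    by simp
  show ?thesis
  proof (rule that)
    show "continuous_on K (\<lambda>x. (\<Sum>i. A (Suc i) x - A i x) + A 0 x)"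
      by (rule uniform_limit_theorem[OF _ lim]) (use contA in auto)
    show "(\<lambda>n. of_real (fst x) ^ n *
        (inv_coord (fst x) ((quad_f (fst x) ^^ n) (q x)) - inv_coord (fst x) ((quad_f (fst x) ^^ n) (q' x))))
      \<longlonglongrightarrow> (\<Sum>i. A (Suc i) x - A i x) + A 0 x" if "x \<in> K" for x
      using tendsto_uniform_limitI[OF lim that] by (simp add: A_def)
  qed
qed

section \<open>The Abel map as a limit of differences\<close>

lemma half_plane_into_disk:
  assumes r: "0 < r" and Z: "1 / (2 * r) < Re Z"
  shows "- 1 / Z \<in> ball (- of_real r) r"
proof -
  have Z0: "Z \<noteq> 0" using Z r by (auto simp: divide_simps)
  have "(norm (of_real r * Z - 1))\<^sup>2 = (r * Re Z - 1)\<^sup>2 + (r * Im Z)\<^sup>2"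
    unfolding cmod_power2 by simp
  also have "\<dots> = r\<^sup>2 * ((Re Z)\<^sup>2 + (Im Z)\<^sup>2) + (1 - 2 * r * Re Z)"
    by (simp add: power2_eq_square algebra_simps)
  also have "\<dots> < r\<^sup>2 * ((Re Z)\<^sup>2 + (Im Z)\<^sup>2)"
    using Z r by (simp add: field_simps)
  also have "\<dots> = (r * norm Z)\<^sup>2"
    by (simp add: power_mult_distrib cmod_power2)
  finally have "norm (of_real r * Z - 1) < r * norm Z"
    using r by (simp add: power2_less_imp_less)
  moreover have "norm (- of_real r - (- 1 / Z)) = norm (of_real r * Z - 1) / norm Z"
  proof -
    have "- of_real r - (- 1 / Z) = - (of_real r * Z - 1) / Z"
      using Z0 by (simp add: field_simps)
    then show ?thesis by (simp add: norm_divide norm_minus_commute)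
  qed
  ultimately show ?thesis
    using Z0 by (simp add: dist_norm divide_less_eq)
qed

lemma funpow_abel:
  assumes "\<And>v. v \<in> interior (filled_julia (quad_f 1)) \<Longrightarrow> \<phi> (quad_f 1 v) = \<phi> v + 1"
    and "v \<in> interior (filled_julia (quad_f 1))"
  shows "\<phi> ((quad_f 1 ^^ n) v) = \<phi> v + of_nat n"
proof (induction n)
  case (Suc n)
  have "\<phi> ((quad_f 1 ^^ Suc n) v) = \<phi> ((quad_f 1 ^^ n) v) + 1"
    using assms(1)[OF iterate_quad_f_interior[OF assms(2)], of n] by simp
  then show ?case using Suc by (simp add: add_ac del: funpow.simps)
qed simp

text \<open>
  Let \<open>\<psi>\<close> be the Abel map in the coordinate \<open>Z\<close>. It is univalent on a half-plane, hence on disks around the orbit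
  points \<open>P\<^sub>n\<close> of \<open>w'\<close> with radii tending to infinity. So the increment of \<open>\<psi>\<close> from \<open>P\<^sub>n\<close> is almost
  \<open>\<psi>'(P\<^sub>n)\<close> times the increment of \<open>Z\<close>. The step from \<open>P\<^sub>n\<close> to \<open>P\<^sub>n\<^sub>+\<^sub>1\<close>, which tends to \<open>1\<close> and raises \<open>\<psi>\<close> by
  \<open>1\<close>, shows that \<open>\<psi>'(P\<^sub>n)\<close> tends to \<open>1\<close>; the step to the orbit of \<open>w\<close> then gives the claim.
\<close>

lemma abel_map_difference:
  assumes \<phi>: "abel_map \<phi>"
    and w: "w \<in> interior (filled_julia (quad_f 1))"
    and w': "w' \<in> interior (filled_julia (quad_f 1))" "(quad_f 1 ^^ N) w' \<in> petal 1"
    and T: "(\<lambda>n. inv_coord 1 ((quad_f 1 ^^ n) w) - inv_coord 1 ((quad_f 1 ^^ n) w')) \<longlonglongrightarrow> T"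
  shows "\<phi> w - \<phi> w' = T"
proof -
  obtain C where C: "C > 0" and affine:
    "\<And>\<psi> p \<rho> t. \<lbrakk>\<psi> holomorphic_on ball p \<rho>; inj_on \<psi> (ball p \<rho>); norm t \<le> \<rho> / 8; 0 < \<rho>\<rbrakk>
       \<Longrightarrow> norm (\<psi> (p + t) - \<psi> p - deriv \<psi> p * t) \<le> C * norm (deriv \<psi> p) * (norm t)\<^sup>2 / \<rho>"
    using univalent_almost_affine by metis
  let ?K = "interior (filled_julia (quad_f 1))"
  have hol: "\<phi> holomorphic_on ?K"
    and eq: "\<And>v. v \<in> ?K \<Longrightarrow> \<phi> (quad_f 1 v) = \<phi> v + 1"
    using \<phi> by (auto simp: abel_map_def holomorphic_branched_covering_def quad_g_eq_quad_f)
  obtain r where r: "r > 0" "ball (- of_real r) r \<subseteq> ?K" "inj_on \<phi> (ball (- of_real r) r)"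
    using \<phi> by (auto simp: abel_map_def quad_g_eq_quad_f)
  define R where "R = 1 / (2 * r)"
  have R: "R > 0" using r by (simp add: R_def)
  define \<psi> where "\<psi> Z = \<phi> (- 1 / Z)" for Z
  have disk: "- 1 / Z \<in> ball (- of_real r) r" if "R < Re Z" for Z
    using half_plane_into_disk r(1) that by (simp add: R_def)
  have hol\<psi>: "\<psi> holomorphic_on {Z. R < Re Z}"
    unfolding \<psi>_def
    by (intro holomorphic_on_compose_gen[OF _ holomorphic_on_subset[OF hol r(2)], unfolded o_def]
          holomorphic_intros) (use R disk in auto)
  have inj\<psi>: "inj_on \<psi> {Z. R < Re Z}"
  proof (rule inj_onI)
    fix x y assume "x \<in> {Z. R < Re Z}" "y \<in> {Z. R < Re Z}" "\<psi> x = \<psi> y"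
    then have "- 1 / x = - 1 / y"
      using disk[of x] disk[of y] inj_onD[OF r(3), of "- 1 / x" "- 1 / y"] by (simp add: \<psi>_def)
    then show "x = y" by simp
  qed
  have \<psi>_inv_coord: "\<psi> (inv_coord 1 v) = \<phi> v" for v by (simp add: \<psi>_def inv_coord_def)
  define P where "P n = inv_coord 1 ((quad_f 1 ^^ n) w')" for n
  define Q where "Q n = inv_coord 1 ((quad_f 1 ^^ n) w)" for n
  define \<rho> where "\<rho> n = Re (P n) - R" for n
  have ReP: "filterlim (\<lambda>n. Re (P n)) at_top sequentially"
  proof -
    have ge: "4 + k / 2 \<le> Re (P (k + N))" for k :: nat
      using petal_iterate(2)[OF _ _ w'(2), of k] by (simp add: P_def funpow_add)
    have "filterlim (\<lambda>k::nat. 4 + real k / 2) at_top sequentially"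
      by real_asymp
    then have "filterlim (\<lambda>k. Re (P (k + N))) at_top sequentially"
      by (rule filterlim_at_top_mono) (intro always_eventually allI ge)
    then show ?thesis
      unfolding filterlim_at_top using eventually_sequentially_seg[of "\<lambda>n. _ \<le> Re (P n)" N] by simp
  qed
  have \<rho>: "filterlim \<rho> at_top sequentially"
    unfolding \<rho>_def using filterlim_tendsto_add_at_top[OF tendsto_const[of "- R"] ReP] by simp
  have \<rho>_inv: "(\<lambda>n. 1 / \<rho> n) \<longlonglongrightarrow> 0"
    using tendsto_divide_0[OF tendsto_const filterlim_at_top_imp_at_infinity[OF \<rho>]] .
  have key: "(\<lambda>n. (\<psi> (P n + t n) - \<psi> (P n)) / deriv \<psi> (P n)) \<longlonglongrightarrow> T'"
    if t: "t \<longlonglongrightarrow> T'" for t :: "nat \<Rightarrow> complex" and T'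
  proof -
    have "\<forall>\<^sub>F n in sequentially. norm (t n) < norm T' + 1"
      using order_tendstoD(2)[OF tendsto_norm[OF t]] by simp
    moreover have "\<forall>\<^sub>F n in sequentially. 8 * norm T' + 8 \<le> \<rho> n"
      using \<rho> by (simp add: filterlim_at_top)
    ultimately have ev: "\<forall>\<^sub>F n in sequentially.
        norm ((\<psi> (P n + t n) - \<psi> (P n)) / deriv \<psi> (P n) - t n) \<le> C * (norm (t n))\<^sup>2 * (1 / \<rho> n)"
    proof eventually_elim
      case (elim n)
      have \<rho>n: "0 < \<rho> n" using elim(2) norm_ge_zero[of T'] by linarith
      have sub: "ball (P n) (\<rho> n) \<subseteq> {Z. R < Re Z}"
      proof
        fix Z assume "Z \<in> ball (P n) (\<rho> n)"
        then have "norm (P n - Z) < \<rho> n" by (simp add: dist_norm)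
        then show "Z \<in> {Z. R < Re Z}"
          using abs_Re_le_cmod[of "P n - Z"] by (simp add: \<rho>_def)
      qed
      have holb: "\<psi> holomorphic_on ball (P n) (\<rho> n)" and injb: "inj_on \<psi> (ball (P n) (\<rho> n))"
        using holomorphic_on_subset[OF hol\<psi> sub] inj_on_subset[OF inj\<psi> sub] by auto
      have d: "deriv \<psi> (P n) \<noteq> 0"
        using holomorphic_injective_imp_regular[OF holb open_ball injb] \<rho>n by simp
      have "norm (\<psi> (P n + t n) - \<psi> (P n) - deriv \<psi> (P n) * t n)
          \<le> C * norm (deriv \<psi> (P n)) * (norm (t n))\<^sup>2 / \<rho> n"
        using elim by (intro affine[OF holb injb _ \<rho>n]) linarith
      moreover have "(\<psi> (P n + t n) - \<psi> (P n)) / deriv \<psi> (P n) - t n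
          = (\<psi> (P n + t n) - \<psi> (P n) - deriv \<psi> (P n) * t n) / deriv \<psi> (P n)"
        using d by (simp add: field_simps)
      ultimately show ?case
        using d by (simp add: norm_divide divide_le_eq mult.commute mult.left_commute)
    qed
    have "(\<lambda>n. C * (norm (t n))\<^sup>2 * (1 / \<rho> n)) \<longlonglongrightarrow> C * (norm T')\<^sup>2 * 0"
      by (intro tendsto_intros t \<rho>_inv)
    then have "(\<lambda>n. (\<psi> (P n + t n) - \<psi> (P n)) / deriv \<psi> (P n) - t n) \<longlonglongrightarrow> 0"
      by (intro Lim_null_comparison[OF ev]) simp
    from tendsto_add[OF this t] show ?thesis by simp
  qed
  have iter: "\<phi> ((quad_f 1 ^^ n) v) = \<phi> v + of_nat n" if "v \<in> ?K" for n v
    using funpow_abel[of \<phi> v n] eq that by blast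
  have "(\<lambda>n. (\<phi> w - \<phi> w') / deriv \<psi> (P n)) \<longlonglongrightarrow> T"
  proof -
    have "\<psi> (Q n) - \<psi> (P n) = \<phi> w - \<phi> w'" for n
      using iter[OF w] iter[OF w'(1)] by (simp add: Q_def P_def \<psi>_inv_coord)
    then show ?thesis
      using key[of "\<lambda>n. Q n - P n" T] T by (simp add: Q_def P_def)
  qed
  moreover have "(\<lambda>n. (\<phi> w - \<phi> w') / deriv \<psi> (P n)) \<longlonglongrightarrow> \<phi> w - \<phi> w'"
  proof -
    have "(\<lambda>n. P (Suc n) - P n) \<longlonglongrightarrow> 1"
    proof -
      have "\<forall>\<^sub>F n in sequentially. 4 < Re (P n)"
        using ReP by (simp add: filterlim_at_top_dense)
      then have "\<forall>\<^sub>F n in sequentially. P (Suc n) - P n = 1 + 1 / (P n - 1)"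
      proof eventually_elim
        case (elim n)
        then show ?case
          using petal_step(1)[of 1 "(quad_f 1 ^^ n) w'"] by (simp add: P_def petal_def)
      qed
      moreover have "filterlim (\<lambda>n. P n - 1) at_infinity sequentially"
      proof -
        have lower: "filterlim (\<lambda>n. - 1 + Re (P n)) at_top sequentially"
          by (rule filterlim_tendsto_add_at_top[OF tendsto_const ReP])
        have ge: "- 1 + Re (P n) \<le> norm (P n - 1)" for n
          using abs_Re_le_cmod[of "P n - 1"] by simp
        have "filterlim (\<lambda>n. norm (P n - 1)) at_top sequentially"
          by (rule filterlim_at_top_mono[OF lower]) (intro always_eventually allI ge)
        then show ?thesis
          by (rule filterlim_norm_at_top_imp_at_infinity)
      qed
      then have "(\<lambda>n. 1 + 1 / (P n - 1)) \<longlonglongrightarrow> 1 + 0"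
        by (intro tendsto_add tendsto_const tendsto_divide_0[OF tendsto_const])
      ultimately show ?thesis
        by (simp add: tendsto_cong)
    qed
    moreover have "\<psi> (P (Suc n)) - \<psi> (P n) = 1" for n
      using iter[OF w'(1), of n] iter[OF w'(1), of "Suc n"]
      by (simp add: P_def \<psi>_inv_coord del: funpow.simps)
    ultimately have "(\<lambda>n. 1 / deriv \<psi> (P n)) \<longlonglongrightarrow> 1"
      using key[of "\<lambda>n. P (Suc n) - P n" 1] by simp
    from tendsto_mult[OF tendsto_const[of "\<phi> w - \<phi> w'"] this] show ?thesis by simp
  qed
  ultimately show ?thesis using LIMSEQ_unique by blast
qed

section \<open>The Schroeder map as a limit of scaled differences\<close>

lemma inverse_near_simple_zero:
  fixes \<phi> :: "complex \<Rightarrow> complex"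
  assumes hol: "\<phi> holomorphic_on ball 0 r" and r: "0 < r"
    and zero: "\<phi> 0 = 0" and a: "deriv \<phi> 0 \<noteq> 0"
  obtains s B where "0 < s"
    "\<And>z. z \<noteq> 0 \<Longrightarrow> norm z < s \<Longrightarrow> \<phi> z \<noteq> 0 \<and> norm (1 / \<phi> z - 1 / (deriv \<phi> 0 * z)) \<le> B"
proof -
  define a where "a = deriv \<phi> 0"
  have "continuous_on (cball 0 (r/2)) \<phi>"
    using r by (intro holomorphic_on_imp_continuous_on holomorphic_on_subset[OF hol]) auto
  then obtain B where B: "\<And>z. z \<in> cball 0 (r/2) \<Longrightarrow> norm (\<phi> z) \<le> B"
    using compact_imp_bounded[OF compact_continuous_image] by (force simp: bounded_iff)
  define M where "M = 32 * B / (r/2)\<^sup>2"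
  have B0: "0 \<le> B" using B[of 0] r zero by simp
  then have M0: "0 \<le> M" by (simp add: M_def)
  have rem: "norm (\<phi> z - a * z) \<le> M * (norm z)\<^sup>2" if "norm z \<le> r/4" for z
  proof -
    have "norm (\<phi> z - \<phi> 0 - deriv \<phi> 0 * z) \<le> 32 * B / (r/2)\<^sup>2 * (norm z)\<^sup>2"
    proof (rule holomorphic_quadratic_remainder)
      show "\<phi> holomorphic_on ball 0 (r/2)"
        by (rule holomorphic_on_subset[OF hol]) (use r in auto)
      show "norm (\<phi> z) \<le> B" if "z \<in> ball 0 (r/2)" for z
        using B that by simp
    qed (use r that in auto)
    then show ?thesis using zero by (simp add: a_def M_def)
  qed
  \<comment> \<open>Below this radius the quadratic term of \<open>\<phi>\<close> is at most half of the linear term.\<close>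
  define s where "s = min (r/4) (norm a / (2 * M + 1))"
  show ?thesis
  proof (rule that)
    show "0 < s" using r a M0 by (auto simp: s_def a_def)
  next
    fix z :: complex assume z: "z \<noteq> 0" "norm z < s"
    then have zr: "norm z \<le> r/4" and "norm z < norm a / (2 * M + 1)" by (auto simp: s_def)
    then have "norm z * (2 * M + 1) < norm a"
      using M0 by (simp add: pos_less_divide_eq)
    moreover have "norm z * (2 * M + 1) = 2 * (M * norm z) + norm z"
      by (simp add: algebra_simps)
    ultimately have "2 * (M * norm z) \<le> norm a"
      using norm_ge_zero[of z] by linarith
    then have "2 * (M * norm z) * norm z \<le> norm a * norm z"
      by (rule mult_right_mono) simp
    then have "M * (norm z)\<^sup>2 \<le> norm (a * z) / 2"
      by (simp add: norm_mult power2_eq_square)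
    then have low: "norm (a * z) / 2 \<le> norm (\<phi> z)"
      using rem[OF zr] norm_triangle_ineq2[of "a * z" "\<phi> z"] by (simp add: norm_minus_commute)
    have az: "0 < norm (a * z)" using z a by (simp add: a_def)
    then have nz: "\<phi> z \<noteq> 0" using low by auto
    have "1 / \<phi> z - 1 / (a * z) = (a * z - \<phi> z) / (\<phi> z * (a * z))"
      using nz az by (simp add: field_simps)
    then have "norm (1 / \<phi> z - 1 / (a * z)) = norm (\<phi> z - a * z) / (norm (\<phi> z) * norm (a * z))"
      by (simp add: norm_divide norm_mult norm_minus_commute)
    also have "\<dots> \<le> M * (norm z)\<^sup>2 / (norm (a * z) / 2 * norm (a * z))"
    proof (rule frac_le)
      show "0 < norm (a * z) / 2 * norm (a * z)"
        using az by (intro mult_pos_pos) auto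
      show "norm (a * z) / 2 * norm (a * z) \<le> norm (\<phi> z) * norm (a * z)"
        using low by (rule mult_right_mono) simp
    qed (use rem[OF zr] M0 in auto)
    also have "\<dots> = 2 * M / (norm a)\<^sup>2"
      using z az by (simp add: norm_mult power2_eq_square)
    finally show "\<phi> z \<noteq> 0 \<and> norm (1 / \<phi> z - 1 / (deriv \<phi> 0 * z)) \<le> 2 * M / (norm a)\<^sup>2"
      using nz by (simp add: a_def)
  qed
qed

lemma petal_orbit_tendsto_0:
  assumes l: "1/2 \<le> l" "l \<le> 1" and w: "(quad_f l ^^ N) w \<in> petal l"
  shows "(\<lambda>n. (quad_f l ^^ n) w) \<longlonglongrightarrow> 0"
proof (rule LIMSEQ_offset[of _ N])
  have le: "norm ((quad_f l ^^ (n + N)) w) \<le> 1 / (4 + real n / 2)" for n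
  proof -
    define v where "v = (quad_f l ^^ (n + N)) w"
    have "4 + real n / 2 \<le> norm (inv_coord l v)"
      using petal_iterate(2)[OF l w, of n] complex_Re_le_cmod order_trans
      by (fastforce simp: v_def funpow_add)
    moreover have "v \<noteq> 0"
      using petal_nonzero[OF petal_iterate(1)[OF l w, of n]] by (simp add: v_def funpow_add)
    then have "norm (inv_coord l v) = l\<^sup>2 / norm v"
      by (simp add: inv_coord_def norm_divide norm_power)
    moreover have "l\<^sup>2 \<le> 1" using l by (simp add: power_le_one)
    ultimately have "(4 + real n / 2) * norm v \<le> 1"
      using \<open>v \<noteq> 0\<close> by (simp add: pos_le_divide_eq)
    then show ?thesis unfolding v_def[symmetric] by (simp add: pos_le_divide_eq mult.commute)
  qed
  have "(\<lambda>n. 1 / (4 + real n / 2)) \<longlonglongrightarrow> 0" by real_asymp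
  then show "(\<lambda>n. (quad_f l ^^ (n + N)) w) \<longlonglongrightarrow> 0"
    by (rule Lim_null_comparison[rotated]) (intro always_eventually allI le)
qed

lemma schroeder_map_deriv_nonzero:
  assumes "schroeder_map l \<phi>"
  shows "deriv \<phi> 0 \<noteq> 0"
proof -
  obtain r where r: "r > 0" "ball 0 r \<subseteq> interior (filled_julia (quad_f l))" "inj_on \<phi> (ball 0 r)"
    using assms by (auto simp: schroeder_map_def)
  have "\<phi> holomorphic_on ball 0 r"
    using assms holomorphic_on_subset r(2)
    by (auto simp: schroeder_map_def holomorphic_branched_covering_def)
  then show ?thesis
    using holomorphic_injective_imp_regular[OF _ open_ball r(3)] r(1) by simp
qed

text \<open>
  The Schroeder equation gives \<open>1 / \<phi> w = l\<^sup>n / \<phi> w\<^sub>n\<close>. Near \<open>0\<close> the functions \<open>1 / \<phi>\<close> and \<open>1 / (a w)\<close>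
  differ by a bounded amount, which the factor \<open>l\<^sup>n\<close> makes negligible.
\<close>

lemma schroeder_map_inverse_limit:
  assumes \<phi>: "schroeder_map l \<phi>" and l: "1/2 \<le> l" "l < 1"
    and w: "w \<in> interior (filled_julia (quad_f l))" "(quad_f l ^^ N) w \<in> petal l"
  shows "\<phi> w \<noteq> 0"
    and "(\<lambda>n. of_real l ^ n * inv_coord l ((quad_f l ^^ n) w) + deriv \<phi> 0 * (of_real l)\<^sup>2 / \<phi> w) \<longlonglongrightarrow> 0"
proof -
  let ?K = "interior (filled_julia (quad_f l))"
  define a where "a = deriv \<phi> 0"
  have a: "a \<noteq> 0" using schroeder_map_deriv_nonzero[OF \<phi>] by (simp add: a_def)
  define v where "v n = (quad_f l ^^ n) w" for n
  have l1: "l \<le> 1" using l by simp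
  have eq: "\<phi> (quad_f l u) = of_real l * \<phi> u" if "u \<in> ?K" for u
    using \<phi> that by (auto simp: schroeder_map_def)
  have \<phi>v: "\<phi> (v n) = of_real l ^ n * \<phi> w" for n
    using eq iterate_quad_f_interior[OF w(1)] by (induction n) (auto simp: v_def)
  obtain r where r: "r > 0" "ball 0 r \<subseteq> ?K"
    using \<phi> by (auto simp: schroeder_map_def)
  have "\<phi> holomorphic_on ball 0 r" "\<phi> 0 = 0"
    using \<phi> holomorphic_on_subset r(2)
    by (auto simp: schroeder_map_def holomorphic_branched_covering_def)
  then obtain s B where s: "0 < s"
    "\<And>z. z \<noteq> 0 \<Longrightarrow> norm z < s \<Longrightarrow> \<phi> z \<noteq> 0 \<and> norm (1 / \<phi> z - 1 / (a * z)) \<le> B"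
    using inverse_near_simple_zero[of \<phi> r] r(1) a unfolding a_def by metis
  have "\<forall>\<^sub>F n in sequentially. norm (v n) < s"
    using order_tendstoD(2)[OF tendsto_norm[OF petal_orbit_tendsto_0[OF l(1) l1 w(2)]], of s] s(1)
    by (simp add: v_def)
  moreover have "\<forall>\<^sub>F n in sequentially. v n \<noteq> 0"
  proof (rule eventually_sequentiallyI)
    fix n assume "N \<le> n"
    then have "v n = (quad_f l ^^ (n - N)) ((quad_f l ^^ N) w)"
      using funpow_add[of "n - N" N "quad_f l"] by (simp add: v_def)
    then show "v n \<noteq> 0"
      using petal_nonzero petal_iterate(1)[OF l(1) l1 w(2)] by metis
  qed
  ultimately have ev: "\<forall>\<^sub>F n in sequentially. v n \<noteq> 0 \<and> norm (v n) < s"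
    by eventually_elim auto
  then obtain n where "v n \<noteq> 0" "norm (v n) < s"
    by (auto simp: eventually_sequentially)
  then show nz: "\<phi> w \<noteq> 0" using s(2)[of "v n"] \<phi>v[of n] by auto
  have "\<forall>\<^sub>F n in sequentially. norm (of_real l ^ n * inv_coord l (v n) + a * (of_real l)\<^sup>2 / \<phi> w)
      \<le> norm (a * (of_real l)\<^sup>2) * B * l ^ n"
    using ev
  proof eventually_elim
    case (elim n)
    have c: "complex_of_real l \<noteq> 0" using l by auto
    have "a * (of_real l)\<^sup>2 * of_real l ^ n * (1 / \<phi> (v n) - 1 / (a * v n))
        = of_real l ^ n * inv_coord l (v n) + a * (of_real l)\<^sup>2 / \<phi> w"
      using a nz c elim by (simp add: \<phi>v inv_coord_def right_diff_distrib)
    moreover have "norm (a * (of_real l)\<^sup>2 * of_real l ^ n) = norm (a * (of_real l)\<^sup>2) * l ^ n"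
      using l by (simp add: norm_mult norm_power)
    ultimately have "norm (of_real l ^ n * inv_coord l (v n) + a * (of_real l)\<^sup>2 / \<phi> w)
        = norm (a * (of_real l)\<^sup>2) * l ^ n * norm (1 / \<phi> (v n) - 1 / (a * v n))"
      by (metis norm_mult)
    also have "\<dots> \<le> norm (a * (of_real l)\<^sup>2) * l ^ n * B"
      using s(2)[of "v n"] elim l by (intro mult_left_mono) auto
    finally show ?case by (simp add: mult_ac)
  qed
  moreover have "(\<lambda>n. norm (a * (of_real l)\<^sup>2) * B * l ^ n) \<longlonglongrightarrow> 0"
    using l by (intro tendsto_mult_right_zero LIMSEQ_power_zero) auto
  ultimately show "(\<lambda>n. of_real l ^ n * inv_coord l ((quad_f l ^^ n) w) + deriv \<phi> 0 * (of_real l)\<^sup>2 / \<phi> w) \<longlonglongrightarrow> 0"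
    unfolding v_def a_def by (rule Lim_null_comparison)
qed

lemma schroeder_map_difference:
  assumes \<phi>: "schroeder_map l \<phi>" and l: "1/2 \<le> l" "l < 1"
    and w: "w \<in> interior (filled_julia (quad_f l))" "(quad_f l ^^ N) w \<in> petal l"
    and w': "w' \<in> interior (filled_julia (quad_f l))" "(quad_f l ^^ N') w' \<in> petal l"
    and T: "(\<lambda>n. of_real l ^ n * (inv_coord l ((quad_f l ^^ n) w) - inv_coord l ((quad_f l ^^ n) w'))) \<longlonglongrightarrow> T"
  shows "deriv \<phi> 0 * (of_real l)\<^sup>2 * (1 / \<phi> w' - 1 / \<phi> w) = T"
proof -
  define k where "k = deriv \<phi> 0 * (of_real l)\<^sup>2"
  have "(\<lambda>n. of_real l ^ n * (inv_coord l ((quad_f l ^^ n) w) - inv_coord l ((quad_f l ^^ n) w'))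
      + (k / \<phi> w - k / \<phi> w')) \<longlonglongrightarrow> 0"
    using tendsto_diff[OF schroeder_map_inverse_limit(2)[OF \<phi> l w]
        schroeder_map_inverse_limit(2)[OF \<phi> l w']]
    by (simp add: k_def algebra_simps)
  moreover have "(\<lambda>n. of_real l ^ n * (inv_coord l ((quad_f l ^^ n) w) - inv_coord l ((quad_f l ^^ n) w'))
      + (k / \<phi> w - k / \<phi> w')) \<longlonglongrightarrow> T + (k / \<phi> w - k / \<phi> w')"
    by (intro tendsto_add T tendsto_const)
  ultimately have "T + (k / \<phi> w - k / \<phi> w') = 0"
    using LIMSEQ_unique by blast
  then have "k / \<phi> w' - k / \<phi> w = T"
    by (simp add: algebra_simps add_eq_0_iff)
  then show ?thesis
    by (simp add: k_def[symmetric] right_diff_distrib)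
qed

section \<open>Passage to the parabolic parameter\<close>

lemma uniform_entry_into_petal:
  assumes E: "compact E" "E \<subseteq> interior (filled_julia (quad_f 1))"
  obtains N where "\<And>w. w \<in> E \<Longrightarrow> (quad_f 1 ^^ N) w \<in> petal 1"
proof -
  define U where "U n = (quad_f 1 ^^ n) -` petal 1" for n
  have op: "open (U n)" for n
    unfolding U_def
    using open_petal[of 1] holomorphic_on_imp_continuous_on[OF holomorphic_on_iterate_quad_f[where l = 1 and n = n and S = UNIV]]
    by (simp add: open_vimage)
  have "E \<subseteq> (\<Union>n. U n)"
    using interior_enters_petal E(2) by (fastforce simp: U_def)
  then obtain C where C: "finite C" "E \<subseteq> (\<Union>n\<in>C. U n)"
    using compactE_image[OF E(1), of UNIV U] op by auto
  show ?thesis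
  proof (rule that)
    fix w assume "w \<in> E"
    then obtain n where n: "n \<in> C" "(quad_f 1 ^^ n) w \<in> petal 1"
      using C by (auto simp: U_def)
    have "n \<le> Max C" using n(1) C(1) by simp
    then have "(quad_f 1 ^^ Max C) w = (quad_f 1 ^^ (Max C - n)) ((quad_f 1 ^^ n) w)"
      using funpow_add[of "Max C - n" n "quad_f 1"] by simp
    then show "(quad_f 1 ^^ Max C) w \<in> petal 1"
      using petal_iterate(1)[OF _ _ n(2), of "Max C - n"] by simp
  qed
qed

text \<open>
  Membership in the petal after \<open>N\<close> steps is the negativity of a function that is continuous in the parameter and
  the point together, so the tube lemma applies.
\<close>

lemma entry_into_petal_stable:
  assumes E: "compact E" and N: "\<And>w. w \<in> E \<Longrightarrow> (quad_f 1 ^^ N) w \<in> petal 1"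
  obtains a where "1/2 \<le> a" "a < 1"
    "\<And>l w. \<lbrakk>a \<le> l; l \<le> 1; w \<in> E\<rbrakk> \<Longrightarrow> (quad_f l ^^ N) w \<in> petal l"
proof -
  define H where "H x = 4 * (norm ((quad_f (fst x) ^^ N) (snd x)))\<^sup>2 + (fst x)\<^sup>2 * Re ((quad_f (fst x) ^^ N) (snd x))" for x
  have "continuous_on UNIV H"
    unfolding H_def by (intro continuous_intros continuous_on_iterate_quad_f)
  then have "open {x. H x < 0}"
    by (intro open_Collect_less) auto
  moreover have "{1} \<times> E \<subseteq> {x. H x < 0}"
    using N by (auto simp: H_def petal_iff_disk)
  ultimately have "\<exists>X. 1 \<in> X \<and> open X \<and> X \<times> E \<subseteq> {x. H x < 0}"
    by (rule Elementary_Topology.tube_lemma[OF E])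
  then obtain X where X: "1 \<in> X" "open X" "X \<times> E \<subseteq> {x. H x < 0}"
    by (elim exE conjE)
  then obtain e where e: "e > 0" "ball 1 e \<subseteq> X"
    by (auto simp: open_contains_ball)
  show ?thesis
  proof (rule that)
    show "1/2 \<le> max (1/2) (1 - e/2)" "max (1/2) (1 - e/2) < 1" using e by auto
    fix l w assume l: "max (1/2) (1 - e/2) \<le> l" "l \<le> 1" and w: "w \<in> E"
    have "l \<in> ball 1 e" using l e by (auto simp: dist_real_def)
    then have "(l, w) \<in> {x. H x < 0}" using e(2) X(3) w by blast
    then have "H (l, w) < 0" by simp
    then show "(quad_f l ^^ N) w \<in> petal l"
      using l by (subst petal_iff_disk) (auto simp: H_def)
  qed
qed

text \<open>
  The difference limit is applied to the orbits from time \<open>N\<close> on, when they are in the petal.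
\<close>

lemma scaled_orbit_limit:
  assumes a: "1/2 \<le> a" and E: "compact E" "w' \<in> E"
    and N: "\<And>l w. \<lbrakk>a \<le> l; l \<le> 1; w \<in> E\<rbrakk> \<Longrightarrow> (quad_f l ^^ N) w \<in> petal l"
  obtains L :: "real \<times> complex \<Rightarrow> complex" where
    "continuous_on ({a..1} \<times> E) L"
    "\<And>l w. \<lbrakk>a \<le> l; l \<le> 1; w \<in> E\<rbrakk> \<Longrightarrow>
      (\<lambda>n. of_real l ^ n * (inv_coord l ((quad_f l ^^ n) w) - inv_coord l ((quad_f l ^^ n) w'))) \<longlonglongrightarrow> L (l, w)"
proof -
  let ?K = "{a..1} \<times> E"
  have q: "continuous_on ?K (\<lambda>x. (quad_f (fst x) ^^ N) (snd x))"
    by (rule continuous_on_iterate_quad_f)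
  have q': "continuous_on ?K (\<lambda>x. (quad_f (fst x) ^^ N) w')"
    using continuous_on_compose[of ?K "\<lambda>x. (fst x, w')" "\<lambda>x. (quad_f (fst x) ^^ N) (snd x)"]
      continuous_on_iterate_quad_f by (simp add: o_def continuous_on_Pair continuous_on_fst)
  have K: "compact ?K" using E by (intro compact_Times) auto
  have l: "1/2 \<le> fst x \<and> fst x \<le> 1" if "x \<in> ?K" for x
    using that a by auto
  have qp: "(quad_f (fst x) ^^ N) (snd x) \<in> petal (fst x)" "(quad_f (fst x) ^^ N) w' \<in> petal (fst x)"
    if "x \<in> ?K" for x
    using that N E(2) by auto
  obtain L where L: "continuous_on ?K L"
    "\<And>x. x \<in> ?K \<Longrightarrow> (\<lambda>n. of_real (fst x) ^ n *
        (inv_coord (fst x) ((quad_f (fst x) ^^ n) ((quad_f (fst x) ^^ N) (snd x))) -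
         inv_coord (fst x) ((quad_f (fst x) ^^ n) ((quad_f (fst x) ^^ N) w')))) \<longlonglongrightarrow> L x"
    using scaled_difference_continuous_limit[OF K l q qp(1) q' qp(2)] by blast
  show ?thesis
  proof (rule that)
    show "continuous_on ?K (\<lambda>x. of_real (fst x) ^ N * L x)"
      by (intro continuous_intros L(1))
    fix l w assume lw: "a \<le> l" "l \<le> 1" "w \<in> E"
    have "(\<lambda>n. of_real l ^ N * (of_real l ^ n *
        (inv_coord l ((quad_f l ^^ n) ((quad_f l ^^ N) w)) - inv_coord l ((quad_f l ^^ n) ((quad_f l ^^ N) w')))))
        \<longlonglongrightarrow> of_real l ^ N * L (l, w)"
      using L(2)[of "(l, w)"] lw by (intro tendsto_intros) auto
    then have "(\<lambda>n. of_real l ^ (n + N) * (inv_coord l ((quad_f l ^^ (n + N)) w) - inv_coord l ((quad_f l ^^ (n + N)) w')))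
        \<longlonglongrightarrow> of_real l ^ N * L (l, w)"
      by (simp add: funpow_add power_add mult_ac)
    then show "(\<lambda>n. of_real l ^ n * (inv_coord l ((quad_f l ^^ n) w) - inv_coord l ((quad_f l ^^ n) w')))
        \<longlonglongrightarrow> of_real (fst (l, w)) ^ N * L (l, w)"
      by (simp add: LIMSEQ_offset[of _ N])
  qed
qed

text \<open>
  The segment contains the critical points \<open>- l / 2\<close> and the critical values \<open>- l\<^sup>2 / 4\<close> of all maps with
  \<open>1/2 \<le> l \<le> 1\<close>.
\<close>

lemma critical_segment_interior:
  "complex_of_real ` {-1/2..-1/16} \<subseteq> interior (filled_julia (quad_f 1))"
proof
  fix w assume "w \<in> complex_of_real ` {-1/2..-1/16}"
  then obtain x where x: "w = of_real x" "- 1/2 \<le> x" "x \<le> - 1/16" by auto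
  define u where "u = x + x\<^sup>2"
  define t where "t = u + u\<^sup>2"
  have range: "- 1/4 \<le> s + s\<^sup>2 \<and> s + s\<^sup>2 < 0" if "- 1 < s" "s < 0" for s :: real
  proof -
    have "s * (1 + s) < 0" using that by (intro mult_neg_pos) auto
    moreover have "0 \<le> (s + 1/2)\<^sup>2" by simp
    ultimately show ?thesis by (simp add: power2_eq_square algebra_simps)
  qed
  have u: "- 1/4 \<le> u" "u < 0" using range[of x] x by (auto simp: u_def)
  have t: "t < 0" using range[of u] u by (auto simp: t_def)
  have "0 < (u + 1/2)\<^sup>2" using u by (intro zero_less_power) simp
  then have t': "- 1/4 < t" by (simp add: t_def power2_eq_square algebra_simps)
  have "4 * t\<^sup>2 + t = t * (4 * t + 1)" by (simp add: power2_eq_square algebra_simps)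
  also have "\<dots> < 0" using t t' by (intro mult_neg_pos) auto
  finally have "complex_of_real t \<in> petal 1"
    using petal_iff_disk[of 1 "of_real t"] by simp
  moreover have "(quad_f 1 ^^ 2) w = of_real t"
    by (simp add: numeral_2_eq_2 quad_f_def x(1) t_def u_def)
  ultimately show "w \<in> interior (filled_julia (quad_f 1))"
    by (intro petal_absorbs_imp_interior[of 1 2]) auto
qed

text \<open>
  By \<open>schroeder_map_difference\<close> and \<open>\<phi> (- l / 2) = 1\<close> the differences of \<open>L\<close> from its value at the critical
  point are \<open>k (1 - 1 / \<phi>)\<close>, and \<open>\<Phi>\<^sub>f\<close> is \<open>l / (l - 1)\<close> times \<open>1 - 1 / \<phi>\<close>. The unknown constant
  \<open>k\<close> drops out on division by the difference at the critical value, where \<open>\<Phi>\<^sub>f = 1\<close>.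
\<close>

lemma moebius_schroeder_eq_quotient:
  assumes \<phi>: "schroeder_map l \<phi>" and l: "1/2 \<le> l" "l < 1"
    and E: "w \<in> E" "- of_real l / 2 \<in> E" "- (of_real l)\<^sup>2 / 4 \<in> E"
      "\<And>w. w \<in> E \<Longrightarrow> (quad_f l ^^ N) w \<in> petal l"
    and L: "\<And>w. w \<in> E \<Longrightarrow>
      (\<lambda>n. of_real l ^ n * (inv_coord l ((quad_f l ^^ n) w) - inv_coord l ((quad_f l ^^ n) w'))) \<longlonglongrightarrow> L w"
  shows "L (- (of_real l)\<^sup>2 / 4) - L (- of_real l / 2) \<noteq> 0"
    and "moebius_S l (\<phi> w) = Some ((L w - L (- of_real l / 2))
            / (L (- (of_real l)\<^sup>2 / 4) - L (- of_real l / 2)))"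
proof -
  let ?c = "- complex_of_real l / 2"
  let ?v = "- (complex_of_real l)\<^sup>2 / 4"
  define k where "k = deriv \<phi> 0 * (complex_of_real l)\<^sup>2"
  define m where "m = complex_of_real l"
  have m: "m \<noteq> 0" "m \<noteq> 1" "m - 1 \<noteq> 0" using l by (auto simp: m_def)
  have k: "k \<noteq> 0"
    using schroeder_map_deriv_nonzero[OF \<phi>] l by (simp add: k_def)
  have int: "u \<in> interior (filled_julia (quad_f l))" if "u \<in> E" for u
    using petal_absorbs_imp_interior[OF l(1) _ E(4)[OF that]] l by simp
  have diff: "k * (1 - 1 / \<phi> u) = L u - L ?c" if u: "u \<in> E" for u
  proof -
    have "(\<lambda>n. of_real l ^ n * (inv_coord l ((quad_f l ^^ n) u) - inv_coord l ((quad_f l ^^ n) ?c))) \<longlonglongrightarrow> L u - L ?c"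
      using tendsto_diff[OF L[OF u] L[OF E(2)]] by (simp add: right_diff_distrib)
    from schroeder_map_difference[OF \<phi> l int[OF u] E(4)[OF u] int[OF E(2)] E(4)[OF E(2)] this]
    show ?thesis using \<phi> by (simp add: k_def schroeder_map_def)
  qed
  have "quad_f l ?c = ?v" by (simp add: quad_f_def power2_eq_square)
  then have "\<phi> ?v = m"
    using \<phi> int[OF E(2)] unfolding schroeder_map_def m_def by (metis mult.right_neutral)
  then have D: "L ?v - L ?c = k * ((m - 1) / m)"
    using diff[OF E(3)] m by (simp add: diff_divide_distrib)
  then show "L ?v - L ?c \<noteq> 0" using k m by simp
  have nz: "\<phi> w \<noteq> 0"
    by (rule schroeder_map_inverse_limit(1)[OF \<phi> l int[OF E(1)] E(4)[OF E(1)]])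
  have "(L w - L ?c) / (L ?v - L ?c) = (k * (1 - 1 / \<phi> w)) / (k * ((m - 1) / m))"
    using diff[OF E(1)] D by simp
  also have "\<dots> = m * (\<phi> w - 1) / ((m - 1) * \<phi> w)"
    using k m nz by (simp add: field_simps)
  finally show "moebius_S l (\<phi> w) = Some ((L w - L ?c) / (L ?v - L ?c))"
    using nz by (simp add: moebius_S_def m_def)
qed

theorem theorem1p2:
  fixes E :: "complex set"
  assumes "compact E" and "E \<subseteq> interior (filled_julia quad_g)"
  shows "(\<forall>\<^sub>F l in at_left 1. E \<subseteq> interior (filled_julia (quad_f l))) \<and>
    (\<forall>(\<phi>\<^sub>f :: real \<Rightarrow> complex \<Rightarrow> complex) (\<phi>\<^sub>g :: complex \<Rightarrow> complex).
       (\<forall>l. 0 < l \<and> l < 1 \<longrightarrow> schroeder_map l (\<phi>\<^sub>f l)) \<and> abel_map \<phi>\<^sub>g \<longrightarrow>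
       (\<forall>\<^sub>F l in at_left 1. \<forall>w\<in>E. moebius_S l (\<phi>\<^sub>f l w) \<noteq> None) \<and>
       uniform_limit E (\<lambda>l w. the (moebius_S l (\<phi>\<^sub>f l w))) \<phi>\<^sub>g (at_left 1))"
proof -
  \<comment> \<open>The quotient formula also evaluates \<open>L\<close> at the critical point and the critical value, which move with \<open>l\<close>.\<close>
  define F where "F = E \<union> complex_of_real ` {-1/2..-1/16}"
  have F: "compact F" "F \<subseteq> interior (filled_julia (quad_f 1))"
    using assms critical_segment_interior
    by (auto simp: F_def quad_g_eq_quad_f intro!: compact_Un compact_continuous_image continuous_intros)
  obtain N where "\<And>w. w \<in> F \<Longrightarrow> (quad_f 1 ^^ N) w \<in> petal 1"
    using uniform_entry_into_petal[OF F] by blast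
  then obtain a where a: "1/2 \<le> a" "a < 1"
    and N: "\<And>l w. \<lbrakk>a \<le> l; l \<le> 1; w \<in> F\<rbrakk> \<Longrightarrow> (quad_f l ^^ N) w \<in> petal l"
    using entry_into_petal_stable[OF F(1)] by blast
  have crit: "- complex_of_real l / 2 \<in> F" and val: "- (complex_of_real l)\<^sup>2 / 4 \<in> F"
    if l: "a \<le> l" "l \<le> 1" for l
  proof -
    have sq: "(1/2)\<^sup>2 \<le> l\<^sup>2" "l\<^sup>2 \<le> 1" using a l by (intro power_mono power_le_one; simp)+
    have "- complex_of_real l / 2 = of_real (- l / 2)" "- l / 2 \<in> {-1/2..-1/16}"
      using a l by auto
    then show "- complex_of_real l / 2 \<in> F" unfolding F_def by blast
    have "- (complex_of_real l)\<^sup>2 / 4 = of_real (- l\<^sup>2 / 4)" "- l\<^sup>2 / 4 \<in> {-1/2..-1/16}"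
      using sq by (auto simp: power2_eq_square)
    then show "- (complex_of_real l)\<^sup>2 / 4 \<in> F" unfolding F_def by blast
  qed
  have near: "\<forall>\<^sub>F l in at_left 1. a < l \<and> l < (1::real)"
    using a(2) by (auto simp: eventually_at_left)
  have part1: "\<forall>\<^sub>F l in at_left 1. E \<subseteq> interior (filled_julia (quad_f l))"
    using near
  proof eventually_elim
    case (elim l)
    show ?case
    proof
      fix w assume "w \<in> E"
      then have "(quad_f l ^^ N) w \<in> petal l" using N elim by (simp add: F_def)
      then show "w \<in> interior (filled_julia (quad_f l))"
        using petal_absorbs_imp_interior[of l N w] a elim by simp
    qed
  qed
  obtain L where contL: "continuous_on ({a..1} \<times> F) L"
    and L: "\<And>l w. \<lbrakk>a \<le> l; l \<le> 1; w \<in> F\<rbrakk> \<Longrightarrow>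
      (\<lambda>n. of_real l ^ n * (inv_coord l ((quad_f l ^^ n) w) - inv_coord l ((quad_f l ^^ n) (- complex_of_real 1 / 2))))
        \<longlonglongrightarrow> L (l, w)"
  proof -
    have "- complex_of_real 1 / 2 \<in> F" using crit[of 1] a(2) by simp
    from scaled_orbit_limit[OF a(1) F(1) this N] show thesis using that by blast
  qed
  \<comment> \<open>The denominator of the quotient formula. It is \<open>1\<close> at \<open>l = 1\<close>, so the formula extends continuously to
    the parabolic parameter.\<close>
  define D where "D l = L (l, - (complex_of_real l)\<^sup>2 / 4) - L (l, - complex_of_real l / 2)" for l
  define G where "G x = (L x - L (fst x, - complex_of_real (fst x) / 2)) / D (fst x)" for x
  have part2: "(\<forall>\<^sub>F l in at_left 1. \<forall>w\<in>E. moebius_S l (\<phi>\<^sub>f l w) \<noteq> None) \<and>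
       uniform_limit E (\<lambda>l w. the (moebius_S l (\<phi>\<^sub>f l w))) \<phi>\<^sub>g (at_left 1)"
    if \<phi>f: "\<And>l. 0 < l \<Longrightarrow> l < 1 \<Longrightarrow> schroeder_map l (\<phi>\<^sub>f l)" and \<phi>g: "abel_map \<phi>\<^sub>g" for \<phi>\<^sub>f \<phi>\<^sub>g
  proof -
    have S: "D l \<noteq> 0" "moebius_S l (\<phi>\<^sub>f l w) = Some (G (l, w))" if "a \<le> l" "l < 1" "w \<in> F" for l w
    proof -
      have "1/2 \<le> l" using a that by simp
      note quot = moebius_schroeder_eq_quotient[OF \<phi>f[of l] this \<open>l < 1\<close> \<open>w \<in> F\<close> crit[of l] val[of l],
          of N "- complex_of_real 1 / 2" "\<lambda>w. L (l, w)"]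
      show "D l \<noteq> 0" "moebius_S l (\<phi>\<^sub>f l w) = Some (G (l, w))"
        using quot N[of l] L[of l] that a by (auto simp: D_def G_def)
    qed
    have abel: "\<phi>\<^sub>g w = L (1, w) - L (1, - complex_of_real 1 / 2)" if "w \<in> F" for w
    proof -
      have c: "- complex_of_real 1 / 2 \<in> F" using crit[of 1] a by simp
      have lim: "(\<lambda>n. inv_coord 1 ((quad_f 1 ^^ n) w) - inv_coord 1 ((quad_f 1 ^^ n) (- complex_of_real 1 / 2)))
          \<longlonglongrightarrow> L (1, w) - L (1, - complex_of_real 1 / 2)"
        using tendsto_diff[OF L[of 1 w] L[OF _ _ c, of 1]] a that by simp
      have "\<phi>\<^sub>g w - \<phi>\<^sub>g (- complex_of_real 1 / 2) = L (1, w) - L (1, - complex_of_real 1 / 2)"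
        using abel_map_difference[OF \<phi>g _ _ N[OF _ _ c] lim] F(2) that c a by auto
      then show ?thesis using \<phi>g by (simp add: abel_map_def)
    qed
    have D1: "D 1 = 1"
    proof -
      have "- 1 / 2 \<in> interior (filled_julia quad_g)"
        using crit[of 1] a F(2) by (auto simp: quad_g_eq_quad_f)
      then have "\<phi>\<^sub>g (quad_g (- 1 / 2)) = 1"
        using \<phi>g by (simp add: abel_map_def)
      moreover have "quad_g (- 1 / 2) = - (complex_of_real 1)\<^sup>2 / 4"
        by (simp add: quad_g_def power2_eq_square)
      ultimately show ?thesis
        using abel[OF val[of 1]] a by (simp add: D_def)
    qed
    have "continuous_on ({a..1} \<times> F) G"
    proof -
      have comp: "continuous_on ({a..1} \<times> F) (\<lambda>x. L (fst x, h (fst x)))"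
        if "continuous_on {a..1} h" "\<And>l. l \<in> {a..1} \<Longrightarrow> h l \<in> F" for h
      proof (rule continuous_on_compose2[OF contL])
        show "continuous_on ({a..1} \<times> F) (\<lambda>x. (fst x, h (fst x)))"
          by (intro continuous_intros continuous_on_compose2[OF that(1)]) auto
      qed (use that(2) in auto)
      have "continuous_on ({a..1} \<times> F) (\<lambda>x. D (fst x))"
        unfolding D_def using crit val
        by (intro continuous_on_diff comp) (auto intro!: continuous_intros)
      moreover have "D (fst x) \<noteq> 0" if "x \<in> {a..1} \<times> F" for x
        using that S(1) D1 by (cases "fst x = 1") auto
      ultimately show ?thesis
        unfolding G_def using crit
        by (intro continuous_on_divide continuous_on_diff contL comp) (auto intro!: continuous_intros)
    qed
    then have unif: "uniformly_continuous_on ({a..1} \<times> F) G"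
      using F(1) by (intro compact_uniformly_continuous compact_Times) auto
    have "uniform_limit E (\<lambda>l w. the (moebius_S l (\<phi>\<^sub>f l w))) \<phi>\<^sub>g (at_left 1)"
    proof (rule uniform_limitI)
      fix e :: real assume "e > 0"
      then obtain d where d: "d > 0"
        "\<And>x y. \<lbrakk>x \<in> {a..1} \<times> F; y \<in> {a..1} \<times> F; dist y x < d\<rbrakk> \<Longrightarrow> dist (G y) (G x) < e"
        using unif unfolding uniformly_continuous_on_def by metis
      have "\<forall>\<^sub>F l in at_left 1. 1 - d < l"
        using d(1) by (intro eventually_at_leftI[of "1 - d"]) auto
      then show "\<forall>\<^sub>F l in at_left 1. \<forall>w\<in>E. dist (the (moebius_S l (\<phi>\<^sub>f l w))) (\<phi>\<^sub>g w) < e"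
        using near
      proof eventually_elim
        case (elim l)
        show ?case
        proof
          fix w assume "w \<in> E"
          then have w: "w \<in> F" by (simp add: F_def)
          have "dist (l, w) (1, w) < d"
            using elim by (simp add: dist_Pair_Pair dist_real_def)
          then have "dist (G (l, w)) (G (1, w)) < e"
            using d(2)[of "(1, w)" "(l, w)"] elim a w by auto
          moreover have "G (1, w) = \<phi>\<^sub>g w"
            using abel[OF w] D1 by (simp add: G_def)
          ultimately show "dist (the (moebius_S l (\<phi>\<^sub>f l w))) (\<phi>\<^sub>g w) < e"
            using S(2)[of l w] elim w by simp
        qed
      qed
    qed
    moreover have "\<forall>\<^sub>F l in at_left 1. \<forall>w\<in>E. moebius_S l (\<phi>\<^sub>f l w) \<noteq> None"
      using near by eventually_elim (auto simp: S(2) F_def)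
    ultimately show ?thesis by blast
  qed
  show ?thesis using part1 part2 by blast
qed

end
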